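(* Let $\Omega\subset\mathbb{C}$ be a simply connected domain, let $\mathbb{D}=\{w\in\mathbb{C} : |w|<1\}$, and let $g_1,g_2:\Omega\to\mathbb{D}$ be nowhere-holomorphic $\mathcal{C}^2$ functions satisfying the compatibility condition $$\mathcal{F}:=\frac{(g_1)_{\overline z}}{(1-g_1\overline{g_2})(1+|g_1|^2)}=\frac{(g_2)_{\overline z}}{(1-\overline{g_1}g_2)(1+|g_2|^2)}\quad\text{on }\Omega .$$ Consider the two equations on $\Omega$: $$\text{(I)}\quad 0=(g_1)_{z\overline z}+\left(\frac{\overline{g_2}}{1-g_1\overline{g_2}}-\frac{\overline{g_1}}{1+|g_1|^2}\right)(g_1)_z(g_1)_{\overline z}+\frac{g_1+g_2}{(1-\overline{g_1}g_2)(1+|g_1|^2)}\,|(g_1)_{\overline z}|^2,$$ $$\text{(II)}\quad 0=(g_2)_{z\overline z}+\left(\frac{\overline{g_1}}{1-\overline{g_1}g_2}-\frac{\overline{g_2}}{1+|g_2|^2}\right)(g_2)_z(g_2)_{\overline z}+\frac{g_1+g_2}{(1-g_1\overline{g_2})(1+|g_2|^2)}\,|(g_2)_{\overline z}|^2 .$$ Assume that at least one of (I), (II) holds on $\Omega$. Then the following hold. (a) Both (I) and (II) hold on $\Omega$. (That is, under the compatibility condition, (I) is equivalent to (II).) (b) Put $f:=-2i\,\overline{\mathcal{F}}$ and define $\phi=(\phi_1,\phi_2,\phi_3,\phi_4):\Omega\to\mathbb{C}^4$ by $$\phi=f\,\bigl(1+g_1g_2,\; i(1-g_1g_2),\; g_1-g_2,\;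 -i(g_1+g_2)\bigr).$$ Then on $\Omega$: (b1) $\phi_1^2+\phi_2^2+\phi_3^2+\phi_4^2=0$; (b2) $|\phi_1|^2+|\phi_2|^2+|\phi_3|^2+|\phi_4|^2>0$; (b3) $\frac{\partial\phi}{\partial\overline z}=\left(\frac{\partial\phi_1}{\partial\overline z},\frac{\partial\phi_2}{\partial\overline z},\frac{\partial\phi_3}{\partial\overline z},\frac{\partial\phi_4}{\partial\overline z}\right)\in\mathbb{R}^4$. (c) There exists a conformal immersion $\mathbf{X}=(x_1,x_2,x_3,x_4):\Omega\to\mathbb{R}^4$ such that: (c1) $\mathbf{X}_z=\phi$ on $\Omega$; (c2) the metric $ds^2$ induced on $\Omega$ by $\mathbf{X}$ is $$ds^2=\frac{16\,|(g_1)_{\overline z}|^2}{|1-g_1\overline{g_2}|^2}\cdot\frac{1+|g_2|^2}{1+|g_1|^2}\,|dz|^2=\frac{16\,|(g_2)_{\overline z}|^2}{|1-\overline{g_1}g_2|^2}\cdot\frac{1+|g_1|^2}{1+|g_2|^2}\,|dz|^2;$$ (c3) the pair $(g_1,g_2)$ is the complexified Gauss map of the surface $\Sigma=\mathbf{X}(\Omega)$, i.e. the generalized Gauss map of $\mathbf{X}$ is $$[\mathbf{X}_z]=\bigl[\,1+g_1g_2,\; i(1-g_1g_2),\; g_1-g_2,\; -i(g_1+g_2)\,\bigr]\in\mathcal{Q}_2\subset\mathbb{C}\mathbb{P}^3;$$ (c4) $\Sigma$ is a translator with translating velocity $-\mathbf{e}_4=(0,0,0,-1)$.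
   Context: Write $z=u+iv$; subscripts $z,\overline z$ denote the Wirtinger derivatives $\partial_z=\tfrac12(\partial_u-i\partial_v)$ and $\partial_{\overline z}=\tfrac12(\partial_u+i\partial_v)$. A function $g$ is nowhere-holomorphic on $\Omega$ if $g_{\overline z}(z)\neq 0$ for every $z\in\Omega$. $\mathcal{Q}_2=\{[\zeta_1:\zeta_2:\zeta_3:\zeta_4]\in\mathbb{C}\mathbb{P}^3 : \zeta_1^2+\zeta_2^2+\zeta_3^2+\zeta_4^2=0\}$, a model of the Grassmannian of oriented planes in $\mathbb{R}^4$. The generalized Gauss map of a conformal immersion $\mathbf{X}:\Omega\to\mathbb{R}^4$ is $z\mapsto[\mathbf{X}_z(z)]\in\mathcal{Q}_2$. When it is written as $[\mathbf{X}_z]=[1+g_1g_2,\ i(1-g_1g_2),\ g_1-g_2,\ -i(g_1+g_2)]$, the pair $(g_1,g_2)$ is called the complexified Gauss map of $\mathbf{X}$. The mean curvature vector of a conformal immersion $\mathbf{X}$ with induced metric $ds^2=\Lambda^2|dz|^2$ is $\mathcal{H}=\triangle_{ds^2}\mathbf{X}=\frac{4}{\Lambda^2}\mathbf{X}_{z\overline z}$. The immersed surface is a translator with translating velocity $V$ (a constant vector of the ambient Euclidean space) if $\mathcal{H}=V^{\perp}$ at every point, where $V^\perp$ is the component of $V$ normal to the surface. *)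

theory Defs
  imports "HOL-Analysis.Analysis"
begin

subsection \<open>Partial derivatives, Wirtinger derivatives, $C^k$ functions on the plane\<close>

definition pd_u :: "(complex \<Rightarrow> 'a::real_normed_vector) \<Rightarrow> complex \<Rightarrow> 'a" where
  "pd_u g z = vector_derivative (\<lambda>t. g (z + of_real t)) (at 0)"

definition pd_v :: "(complex \<Rightarrow> 'a::real_normed_vector) \<Rightarrow> complex \<Rightarrow> 'a" where
  "pd_v g z = vector_derivative (\<lambda>t. g (z + \<i> * of_real t)) (at 0)"

definition d_z :: "(complex \<Rightarrow> complex) \<Rightarrow> complex \<Rightarrow> complex" where
  "d_z g z = (1/2) * (pd_u g z - \<i> * pd_v g z)"

definition d_zbar :: "(complex \<Rightarrow> complex) \<Rightarrow> complex \<Rightarrow> complex" where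
  "d_zbar g z = (1/2) * (pd_u g z + \<i> * pd_v g z)"

text \<open>Functions of class $C^k$ on an open set; real differentiability is meant throughout.\<close>

primrec Ck_on :: "nat \<Rightarrow> (complex \<Rightarrow> 'a::real_normed_vector) \<Rightarrow> complex set \<Rightarrow> bool" where
  "Ck_on 0 g S \<longleftrightarrow> continuous_on S g"
| "Ck_on (Suc k) g S \<longleftrightarrow>
     (\<forall>z\<in>S. g differentiable (at z)) \<and> Ck_on k (pd_u g) S \<and> Ck_on k (pd_v g) S"

definition nowhere_holomorphic :: "(complex \<Rightarrow> complex) \<Rightarrow> complex set \<Rightarrow> bool" where
  "nowhere_holomorphic g S \<longleftrightarrow> (\<forall>z\<in>S. d_zbar g z \<noteq> 0)"

text \<open>Componentwise Wirtinger derivatives of maps into $\mathbb{C}^n$, and the inclusion of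
  $\mathbb{R}^n$ into $\mathbb{C}^n$, through which they also act on maps into $\mathbb{R}^n$.\<close>

definition vd_z :: "(complex \<Rightarrow> complex ^ 'n) \<Rightarrow> complex \<Rightarrow> complex ^ 'n" where
  "vd_z \<psi> z = (\<chi> k. d_z (\<lambda>w. \<psi> w $ k) z)"

definition vd_zbar :: "(complex \<Rightarrow> complex ^ 'n) \<Rightarrow> complex \<Rightarrow> complex ^ 'n" where
  "vd_zbar \<psi> z = (\<chi> k. d_zbar (\<lambda>w. \<psi> w $ k) z)"

definition cvec :: "real ^ 'n \<Rightarrow> complex ^ 'n" where
  "cvec x = (\<chi> k. complex_of_real (x $ k))"

definition surface_z :: "(complex \<Rightarrow> real ^ 'n) \<Rightarrow> complex \<Rightarrow> complex ^ 'n" where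
  "surface_z X = vd_z (\<lambda>w. cvec (X w))"


subsection \<open>Conformal immersions and translators\<close>

definition induced_metric ::
    "(complex \<Rightarrow> 'a::real_inner) \<Rightarrow> complex \<Rightarrow> complex \<Rightarrow> complex \<Rightarrow> real" where
  "induced_metric X z v w = frechet_derivative X (at z) v \<bullet> frechet_derivative X (at z) w"

text \<open>The induced metric equals $L\,|dz|^2$; the Euclidean metric $|dz|^2$ of the plane is the
  real inner product of \<^typ>\<open>complex\<close>.\<close>

definition has_induced_metric ::
    "(complex \<Rightarrow> 'a::real_inner) \<Rightarrow> complex set \<Rightarrow> (complex \<Rightarrow> real) \<Rightarrow> bool" where
  "has_induced_metric X S L \<longleftrightarrow> (\<forall>z\<in>S. \<forall>v w. induced_metric X z v w = L z * (v \<bullet> w))"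

text \<open>Immersions are taken of class $C^2$, the regularity needed for the mean curvature vector.\<close>

definition conformal_immersion :: "(complex \<Rightarrow> 'a::real_inner) \<Rightarrow> complex set \<Rightarrow> bool" where
  "conformal_immersion X S \<longleftrightarrow>
     Ck_on 2 X S \<and>
     (\<forall>z\<in>S. inj (frechet_derivative X (at z))) \<and>
     (\<exists>L. has_induced_metric X S L)"

text \<open>The factor $\Lambda^2$ of a conformal immersion with induced metric $\Lambda^2|dz|^2$.\<close>

definition conformal_factor :: "(complex \<Rightarrow> 'a::real_inner) \<Rightarrow> complex \<Rightarrow> real" where
  "conformal_factor X z = induced_metric X z 1 1"

text \<open>The vector $\frac{4}{\Lambda^2}X_{z\bar z}$, as an element of
  $\mathbb{R}^n \subseteq \mathbb{C}^n$.\<close>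

definition mean_curvature_vector :: "(complex \<Rightarrow> real ^ 'n) \<Rightarrow> complex \<Rightarrow> complex ^ 'n" where
  "mean_curvature_vector X z =
     complex_of_real (4 / conformal_factor X z) *s vd_zbar (surface_z X) z"

definition tangent_plane ::
    "(complex \<Rightarrow> 'a::real_normed_vector) \<Rightarrow> complex \<Rightarrow> 'a set" where
  "tangent_plane X z = range (frechet_derivative X (at z))"

definition normal_component :: "'a::euclidean_space set \<Rightarrow> 'a \<Rightarrow> 'a" where
  "normal_component T V = (THE N. N \<in> orthogonal_comp T \<and> V - N \<in> T)"

definition is_translator ::
    "(complex \<Rightarrow> real ^ 'n) \<Rightarrow> complex set \<Rightarrow> real ^ 'n \<Rightarrow> bool" where
  "is_translator X S V \<longleftrightarrow>
     (\<forall>z\<in>S. mean_curvature_vector X z = cvec (normal_component (tangent_plane X z) V))"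


subsection \<open>The complex quadric and the Gauss map\<close>

text \<open>For \<^prop>\<open>\<zeta> \<noteq> 0\<close>, the point $[\zeta]$ of projective space is the set of all
  homogeneous coordinate vectors representing it.\<close>

definition proj_class :: "complex ^ 'n \<Rightarrow> (complex ^ 'n) set" where
  "proj_class \<zeta> = {c *s \<zeta> | c. c \<noteq> 0}"

definition quadric2 :: "(complex ^ 4) set set" where
  "quadric2 = {proj_class \<zeta> | \<zeta>.
     \<zeta> \<noteq> 0 \<and> (\<zeta> $ 1)\<^sup>2 + (\<zeta> $ 2)\<^sup>2 + (\<zeta> $ 3)\<^sup>2 + (\<zeta> $ 4)\<^sup>2 = 0}"

definition gauss_map :: "(complex \<Rightarrow> real ^ 4) \<Rightarrow> complex \<Rightarrow> (complex ^ 4) set" where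
  "gauss_map X z = proj_class (surface_z X z)"

definition gauss_vec :: "complex \<Rightarrow> complex \<Rightarrow> complex ^ 4" where
  "gauss_vec a b = vector [1 + a * b, \<i> * (1 - a * b), a - b, - \<i> * (a + b)]"

definition complexified_gauss_map ::
    "(complex \<Rightarrow> real ^ 4) \<Rightarrow> complex set \<Rightarrow>
     (complex \<Rightarrow> complex) \<Rightarrow> (complex \<Rightarrow> complex) \<Rightarrow> bool" where
  "complexified_gauss_map X S g1 g2 \<longleftrightarrow>
     (\<forall>z\<in>S. gauss_map X z = proj_class (gauss_vec (g1 z) (g2 z)) \<and> gauss_map X z \<in> quadric2)"


subsection \<open>The two equations\<close>

definition equation_I ::
    "(complex \<Rightarrow> complex) \<Rightarrow> (complex \<Rightarrow> complex) \<Rightarrow> complex \<Rightarrow> bool" where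
  "equation_I g1 g2 z \<longleftrightarrow>
     0 = d_zbar (d_z g1) z
         + (cnj (g2 z) / (1 - g1 z * cnj (g2 z))
            - cnj (g1 z) / (1 + of_real ((cmod (g1 z))\<^sup>2))) * d_z g1 z * d_zbar g1 z
         + (g1 z + g2 z) / ((1 - cnj (g1 z) * g2 z) * (1 + of_real ((cmod (g1 z))\<^sup>2)))
           * of_real ((cmod (d_zbar g1 z))\<^sup>2)"

definition equation_II ::
    "(complex \<Rightarrow> complex) \<Rightarrow> (complex \<Rightarrow> complex) \<Rightarrow> complex \<Rightarrow> bool" where
  "equation_II g1 g2 z \<longleftrightarrow>
     0 = d_zbar (d_z g2) z
         + (cnj (g1 z) / (1 - cnj (g1 z) * g2 z)
            - cnj (g2 z) / (1 + of_real ((cmod (g2 z))\<^sup>2))) * d_z g2 z * d_zbar g2 z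
         + (g1 z + g2 z) / ((1 - g1 z * cnj (g2 z)) * (1 + of_real ((cmod (g2 z))\<^sup>2)))
           * of_real ((cmod (d_zbar g2 z))\<^sup>2)"

end

(* Write F for the common value in the compatibility condition, so that the z-bar-derivatives of
   g1 and g2 are explicit multiples of F. Since mixed second derivatives commute, substituting this
   into (I) cancels every derivative of g1 and g2 and leaves
     F_z = - |F|^2 (g1 + g2 - g1 g2 (cnj g1 + cnj g2)),
   which is symmetric in g1 and g2 and therefore also equivalent to (II). With this value of F_z,
     (phi_k)_zbar = Re (cnj phi_4 * phi_k) - (L / 4) * delta_k4,   where L = 2 |phi|^2.
   The right-hand side is real, so the forms 2 Re (phi_k dz) are closed and have primitives x_k on
   the simply connected domain. The same identity says that -e_4 - (4 / L) X_{z zbar} is the tangent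
   vector dX (-2 cnj phi_4 / L); together with X being conformal this gives the translator
   equation. *)

theory Submission
  imports Defs "HOL-Complex_Analysis.Riemann_Mapping"
begin

section \<open>Wirtinger calculus\<close>

lemma has_derivative_pd:
  fixes g :: "complex \<Rightarrow> 'a::real_normed_vector"
  assumes "(g has_derivative D) (at z)"
  shows "((\<lambda>t. g (z + of_real t)) has_vector_derivative D 1) (at 0)"
    and "((\<lambda>t. g (z + \<i> * of_real t)) has_vector_derivative D \<i>) (at 0)"
    and "pd_u g z = D 1" and "pd_v g z = D \<i>"
proof -
  interpret bounded_linear D using assms by (rule has_derivative_bounded_linear)
  have *: "((\<lambda>t. g (z + c * of_real t)) has_vector_derivative D c) (at (0::real))" for c
  proof -
    have 1: "((\<lambda>t::real. z + c * of_real t) has_derivative (\<lambda>t. c * of_real t)) (at 0)"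
      by (auto intro!: derivative_eq_intros)
    have 2: "(g has_derivative D) (at (z + c * of_real 0))" using assms by simp
    have "((\<lambda>t. g (z + c * of_real t)) has_derivative (\<lambda>t. D (c * of_real t))) (at (0::real))"
      using has_derivative_compose[OF 1 2] .
    moreover have "D (c * of_real t) = t *\<^sub>R D c" for t :: real
      using scaleR[of t c] by (simp add: scaleR_conv_of_real mult.commute)
    ultimately show ?thesis by (simp add: has_vector_derivative_def)
  qed
  show 1: "((\<lambda>t. g (z + of_real t)) has_vector_derivative D 1) (at 0)" using *[of 1] by simp
  show 2: "((\<lambda>t. g (z + \<i> * of_real t)) has_vector_derivative D \<i>) (at 0)" by (rule *)
  show "pd_u g z = D 1" "pd_v g z = D \<i>"
    unfolding pd_u_def pd_v_def using 1 2 by (auto intro: vector_derivative_at)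
qed

text \<open>A real-linear map on the plane is determined by its values at \<open>1\<close> and
  \<open>\<i>\<close>, and for the derivative these values are the two partial derivatives.\<close>

lemma differentiable_pd:
  fixes g :: "complex \<Rightarrow> 'a::real_normed_vector"
  assumes "g differentiable (at z)"
  shows "(g has_derivative (\<lambda>h. Re h *\<^sub>R pd_u g z + Im h *\<^sub>R pd_v g z)) (at z)"
proof -
  obtain D where D: "(g has_derivative D) (at z)" using assms unfolding differentiable_def by blast
  interpret bounded_linear D using D by (rule has_derivative_bounded_linear)
  have "D h = Re h *\<^sub>R pd_u g z + Im h *\<^sub>R pd_v g z" for h
  proof -
    have "h = Re h *\<^sub>R 1 + Im h *\<^sub>R \<i>" by (simp add: complex_eq_iff)
    then have "D h = Re h *\<^sub>R D 1 + Im h *\<^sub>R D \<i>" by (metis add scaleR)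
    then show ?thesis using has_derivative_pd(3,4)[OF D] by simp
  qed
  then have "D = (\<lambda>h. Re h *\<^sub>R pd_u g z + Im h *\<^sub>R pd_v g z)" by auto
  then show ?thesis using D by simp
qed

text \<open>Every real-linear map of the plane is \<open>h \<mapsto> p * h + q * cnj h\<close> for
  exactly one pair \<open>p\<close>, \<open>q\<close>. One predicate thus records real
  differentiability together with both Wirtinger derivatives, and their calculus reduces to rules
  for \<open>has_derivative\<close>.\<close>

definition has_wirt :: "(complex \<Rightarrow> complex) \<Rightarrow> complex \<Rightarrow> complex \<Rightarrow> complex \<Rightarrow> bool" where
  "has_wirt g p q z \<longleftrightarrow> (g has_derivative (\<lambda>h. p * h + q * cnj h)) (at z)"

lemma has_wirt_D:
  assumes "has_wirt g p q z"
  shows "d_z g z = p" "d_zbar g z = q" "pd_u g z = p + q" "pd_v g z = \<i> * (p - q)"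
    "g differentiable (at z)"
proof -
  have 1: "pd_u g z = p + q" and 2: "pd_v g z = \<i> * (p - q)"
    using has_derivative_pd(3,4)[OF assms[unfolded has_wirt_def]] by (auto simp: algebra_simps)
  then show "pd_u g z = p + q" "pd_v g z = \<i> * (p - q)" by auto
  have ii: "\<i> * (\<i> * x) = - x" for x :: complex
    by (simp add: mult.assoc[symmetric])
  show "d_z g z = p" "d_zbar g z = q"
    unfolding d_z_def d_zbar_def 1 2 ii by (simp_all add: field_simps)
  show "g differentiable (at z)" using assms unfolding has_wirt_def differentiable_def by blast
qed

lemma differentiable_has_wirt:
  assumes "g differentiable (at z)"
  shows "has_wirt g (d_z g z) (d_zbar g z) z"
proof -
  have "d_z g z * h + d_zbar g z * cnj h = Re h *\<^sub>R pd_u g z + Im h *\<^sub>R pd_v g z" for h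
    unfolding d_z_def d_zbar_def by (simp add: complex_eq_iff field_simps)
  then show ?thesis using differentiable_pd[OF assms] unfolding has_wirt_def by simp
qed

lemma has_wirt_const: "has_wirt (\<lambda>w. c) 0 0 z"
  unfolding has_wirt_def by (auto intro!: derivative_eq_intros)

lemma has_wirt_add:
  assumes "has_wirt f p q z" "has_wirt g r s z"
  shows "has_wirt (\<lambda>w. f w + g w) (p + r) (q + s) z"
  unfolding has_wirt_def
  by (rule derivative_eq_intros assms[unfolded has_wirt_def])+ (auto simp: algebra_simps)

lemma has_wirt_diff:
  assumes "has_wirt f p q z" "has_wirt g r s z"
  shows "has_wirt (\<lambda>w. f w - g w) (p - r) (q - s) z"
  unfolding has_wirt_def
  by (rule derivative_eq_intros assms[unfolded has_wirt_def])+ (auto simp: algebra_simps)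

lemma has_wirt_mult:
  assumes "has_wirt f p q z" "has_wirt g r s z"
  shows "has_wirt (\<lambda>w. f w * g w) (p * g z + f z * r) (q * g z + f z * s) z"
  unfolding has_wirt_def
  by (rule derivative_eq_intros assms[unfolded has_wirt_def])+ (auto simp: algebra_simps)

lemma has_wirt_cnj:
  assumes "has_wirt f p q z"
  shows "has_wirt (\<lambda>w. cnj (f w)) (cnj q) (cnj p) z"
  unfolding has_wirt_def
  by (rule derivative_eq_intros assms[unfolded has_wirt_def])+ (auto simp: algebra_simps)

lemma has_wirt_inverse:
  assumes "has_wirt f p q z" "f z \<noteq> 0"
  shows "has_wirt (\<lambda>w. inverse (f w)) (- p / (f z)\<^sup>2) (- q / (f z)\<^sup>2) z"
  unfolding has_wirt_def
  by (rule derivative_eq_intros assms[unfolded has_wirt_def] assms(2))+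
     (use assms(2) in \<open>auto simp: field_simps power2_eq_square\<close>)

text \<open>The derivative of a holomorphic inner map is multiplication by \<open>h'\<close>, so
  linear and conjugate-linear parts do not mix. This serves to transport a form along the Riemann
  map.\<close>

lemma has_wirt_chain_holomorphic:
  assumes "has_wirt f p q (h z)" "(h has_field_derivative h') (at z)"
  shows "has_wirt (\<lambda>w. f (h w)) (p * h') (q * cnj h') z"
  unfolding has_wirt_def
  by (rule has_derivative_eq_rhs, rule has_derivative_compose[OF assms(2)[unfolded has_field_derivative_def] assms(1)[unfolded has_wirt_def]])
     (auto simp: algebra_simps)

lemma has_wirt_holomorphic:
  assumes "(h has_field_derivative h') (at z)"
  shows "has_wirt h h' 0 z"
  using assms unfolding has_wirt_def has_field_derivative_def by simp

section \<open>Locality of derivatives and closure properties of C^1 functions\<close>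

lemma has_wirt_cong:
  assumes "has_wirt f p q z" "open S" "z \<in> S" "\<And>w. w \<in> S \<Longrightarrow> f w = g w"
  shows "has_wirt g p q z"
  using assms has_derivative_transform_within_open unfolding has_wirt_def by blast

lemma pd_cong:
  fixes f g :: "complex \<Rightarrow> 'a::real_normed_vector"
  assumes "f differentiable (at z)" "open S" "z \<in> S" "\<And>w. w \<in> S \<Longrightarrow> f w = g w"
  shows "g differentiable (at z)" "pd_u g z = pd_u f z" "pd_v g z = pd_v f z"
proof -
  obtain D where D: "(f has_derivative D) (at z)" using assms unfolding differentiable_def by blast
  then have "(g has_derivative D) (at z)"
    using assms has_derivative_transform_within_open by blast
  then show "g differentiable (at z)" "pd_u g z = pd_u f z" "pd_v g z = pd_v f z"
    using has_derivative_pd(3,4) D differentiable_def by metis+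
qed

lemma Ck_on_cong:
  fixes f g :: "complex \<Rightarrow> 'a::real_normed_vector"
  assumes "Ck_on k f S" "open S" "\<And>w. w \<in> S \<Longrightarrow> f w = g w"
  shows "Ck_on k g S"
  using assms
proof (induction k arbitrary: f g)
  case 0
  then show ?case by (metis Ck_on.simps(1) continuous_on_cong)
next
  case (Suc k)
  have "g differentiable (at z)" "pd_u g z = pd_u f z" "pd_v g z = pd_v f z" if "z \<in> S" for z
    using pd_cong[of f z S g] Suc.prems that by auto
  then show ?case
    using Suc.IH[of "pd_u f" "pd_u g"] Suc.IH[of "pd_v f" "pd_v g"] Suc.prems by simp
qed

lemma Ck_on_Suc_D:
  assumes "Ck_on (Suc k) f S"
  shows "continuous_on S f"
  using assms by (auto simp: continuous_on_eq_continuous_within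
      intro: differentiable_imp_continuous_within differentiable_at_withinI)

text \<open>The partial derivatives are fixed linear combinations of \<open>p\<close> and
  \<open>q\<close>, so continuity can be checked on the Wirtinger side. The closure rules below all
  go through this criterion.\<close>

lemma Ck_on_1I:
  assumes "\<And>z. z \<in> S \<Longrightarrow> has_wirt f (p z) (q z) z" "continuous_on S p" "continuous_on S q"
  shows "Ck_on 1 f S"
proof -
  have "continuous_on S (pd_u f) = continuous_on S (\<lambda>z. p z + q z)"
    "continuous_on S (pd_v f) = continuous_on S (\<lambda>z. \<i> * (p z - q z))"
    using has_wirt_D(3,4)[OF assms(1)] by (auto intro: continuous_on_cong)
  then show ?thesis
    using assms(2,3) has_wirt_D(5)[OF assms(1)] by (auto intro!: continuous_intros)
qed

lemma Ck_on_1D: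
  assumes "Ck_on 1 f S"
  shows "z \<in> S \<Longrightarrow> has_wirt f (d_z f z) (d_zbar f z) z"
    and "continuous_on S f" "continuous_on S (d_z f)" "continuous_on S (d_zbar f)"
  using assms differentiable_has_wirt Ck_on_Suc_D[of 0 f S]
  unfolding d_z_def[abs_def] d_zbar_def[abs_def] by (auto intro!: continuous_intros)

lemma Ck_on_1_const: "Ck_on 1 (\<lambda>w. c :: complex) S"
  by (rule Ck_on_1I, rule has_wirt_const) auto

lemma Ck_on_1_add:
  fixes f g :: "complex \<Rightarrow> complex"
  assumes "Ck_on 1 f S" "Ck_on 1 g S"
  shows "Ck_on 1 (\<lambda>w. f w + g w) S"
  by (rule Ck_on_1I, rule has_wirt_add[OF Ck_on_1D(1)[OF assms(1)] Ck_on_1D(1)[OF assms(2)]])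
     (auto intro!: continuous_intros Ck_on_1D(2-4)[OF assms(1)] Ck_on_1D(2-4)[OF assms(2)])

lemma Ck_on_1_diff:
  fixes f g :: "complex \<Rightarrow> complex"
  assumes "Ck_on 1 f S" "Ck_on 1 g S"
  shows "Ck_on 1 (\<lambda>w. f w - g w) S"
  by (rule Ck_on_1I, rule has_wirt_diff[OF Ck_on_1D(1)[OF assms(1)] Ck_on_1D(1)[OF assms(2)]])
     (auto intro!: continuous_intros Ck_on_1D(2-4)[OF assms(1)] Ck_on_1D(2-4)[OF assms(2)])

lemma Ck_on_1_mult:
  fixes f g :: "complex \<Rightarrow> complex"
  assumes "Ck_on 1 f S" "Ck_on 1 g S"
  shows "Ck_on 1 (\<lambda>w. f w * g w) S"
  by (rule Ck_on_1I, rule has_wirt_mult[OF Ck_on_1D(1)[OF assms(1)] Ck_on_1D(1)[OF assms(2)]])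
     (auto intro!: continuous_intros Ck_on_1D(2-4)[OF assms(1)] Ck_on_1D(2-4)[OF assms(2)])

lemma Ck_on_1_cnj:
  fixes f :: "complex \<Rightarrow> complex"
  assumes "Ck_on 1 f S"
  shows "Ck_on 1 (\<lambda>w. cnj (f w)) S"
  by (rule Ck_on_1I, rule has_wirt_cnj[OF Ck_on_1D(1)[OF assms(1)]])
     (auto intro!: continuous_intros Ck_on_1D(2-4)[OF assms(1)])

lemma Ck_on_1_divide:
  fixes f g :: "complex \<Rightarrow> complex"
  assumes "Ck_on 1 f S" "Ck_on 1 g S" "\<And>w. w \<in> S \<Longrightarrow> g w \<noteq> 0"
  shows "Ck_on 1 (\<lambda>w. f w / g w) S"
proof -
  have "Ck_on 1 (\<lambda>w. inverse (g w)) S"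
    by (rule Ck_on_1I, rule has_wirt_inverse[OF Ck_on_1D(1)[OF assms(2)]])
       (use assms(3) in \<open>auto intro!: continuous_intros Ck_on_1D(2-4)[OF assms(2)]\<close>)
  from Ck_on_1_mult[OF assms(1) this] show ?thesis by (simp add: divide_inverse)
qed

section \<open>Symmetry of second derivatives\<close>

text \<open>The second difference over the parallelogram with sides \<open>h * p\<close> and
  \<open>h * q\<close> is handled by two mean value theorems, one in each direction. Each
  contributes a factor \<open>h\<close>.\<close>

lemma second_difference_mean_value:
  fixes f G H :: "complex \<Rightarrow> real"
  assumes f: "\<And>w. w \<in> ball z e \<Longrightarrow>
      ((\<lambda>t. f (w + p * of_real t)) has_vector_derivative G w) (at 0)"
    and G: "\<And>w. w \<in> ball z e \<Longrightarrow>
      ((\<lambda>t. G (w + q * of_real t)) has_vector_derivative H w) (at 0)"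
    and h: "0 < h" "2 * h < e" and "cmod p = 1" "cmod q = 1"
  shows "\<exists>w \<in> cball z (2 * h). f (z + p * h + q * h) - f (z + p * h) - f (z + q * h) + f z = h\<^sup>2 * H w"
proof -
  have near: "dist z (z + p * of_real s + q * of_real t) \<le> 2 * h"
    if "0 \<le> s" "s \<le> h" "0 \<le> t" "t \<le> h" for s t
  proof -
    have "cmod (p * of_real s + q * of_real t) \<le> cmod (p * of_real s) + cmod (q * of_real t)"
      by (rule norm_triangle_ineq)
    also have "\<dots> = s + t" using that assms by (simp add: norm_mult)
    finally have "cmod (p * of_real s + q * of_real t) \<le> 2 * h" using that by simp
    then show ?thesis
      by (metis add.assoc add_diff_cancel_left' dist_commute dist_norm)
  qed
  \<comment> \<open>Directional derivatives are given at parameter 0 of a line through the point;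
    the mean value theorem needs them at parameter \<open>s\<close> of one fixed line.\<close>
  have shift: "((\<lambda>t. k (w + r * of_real t)) has_real_derivative D) (at s)"
    if "((\<lambda>t. k (w + r * of_real s + r * of_real t)) has_vector_derivative D) (at 0)"
    for k :: "complex \<Rightarrow> real" and w r s D
    using DERIV_shift[of "\<lambda>t. k (w + r * of_real t)" D 0 s] that
    by (simp add: has_real_derivative_iff_has_vector_derivative algebra_simps)
  \<comment> \<open>First mean value theorem, along \<open>p\<close>, for the increment of
    \<open>f\<close> in direction \<open>q\<close>. The second one, along \<open>q\<close>, is
    applied to \<open>G\<close>.\<close>
  have "DERIV (\<lambda>t. f (z + q * h + p * of_real t) - f (z + p * of_real t)) s :>
      G (z + q * h + p * of_real s) - G (z + p * of_real s)" if "0 \<le> s" "s \<le> h" for s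
    using near[of s h] near[of s 0] that h
    by (intro DERIV_diff shift f) (auto simp: algebra_simps)
  from MVT2[OF h(1) this] obtain s where s: "0 < s" "s < h"
    "f (z + q * h + p * h) - f (z + p * h) - (f (z + q * h) - f z)
      = h * (G (z + q * h + p * of_real s) - G (z + p * of_real s))"
    by auto
  have "DERIV (\<lambda>t. G (z + p * of_real s + q * of_real t)) t :> H (z + p * of_real s + q * of_real t)"
    if "0 \<le> t" "t \<le> h" for t
    using near[of s t] that h s by (intro shift G) auto
  from MVT2[OF h(1) this] obtain t where t: "0 < t" "t < h"
    "G (z + p * of_real s + q * h) - G (z + p * of_real s) = h * H (z + p * of_real s + q * of_real t)"
    by auto
  have "f (z + p * h + q * h) - f (z + p * h) - f (z + q * h) + f z
      = h\<^sup>2 * H (z + p * of_real s + q * of_real t)"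
    using s(3) t(3) by (simp add: algebra_simps power2_eq_square)
  moreover have "z + p * of_real s + q * of_real t \<in> cball z (2 * h)"
    using near[of s t] s t by simp
  ultimately show ?thesis by blast
qed

text \<open>The second difference is symmetric in the two directions, so it forces \<open>H1\<close>
  and \<open>H2\<close> to agree at two points arbitrarily close to \<open>z\<close>. Continuity
  then excludes a gap at \<open>z\<close>.\<close>

lemma mixed_derivatives_eq_real:
  fixes f G1 G2 H1 H2 :: "complex \<Rightarrow> real"
  assumes S: "open S" "z \<in> S"
    and f: "\<And>w. w \<in> S \<Longrightarrow> ((\<lambda>t. f (w + of_real t)) has_vector_derivative G1 w) (at 0)"
      "\<And>w. w \<in> S \<Longrightarrow> ((\<lambda>t. f (w + \<i> * of_real t)) has_vector_derivative G2 w) (at 0)"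
    and G: "\<And>w. w \<in> S \<Longrightarrow> ((\<lambda>t. G1 (w + \<i> * of_real t)) has_vector_derivative H1 w) (at 0)"
      "\<And>w. w \<in> S \<Longrightarrow> ((\<lambda>t. G2 (w + of_real t)) has_vector_derivative H2 w) (at 0)"
    and H: "continuous_on S H1" "continuous_on S H2"
  shows "H1 z = H2 z"
proof (rule ccontr)
  assume neq: "H1 z \<noteq> H2 z"
  \<comment> \<open>Half the supposed gap: values within this distance of \<open>H1 z\<close> and of
    \<open>H2 z\<close> cannot coincide.\<close>
  define \<epsilon> where "\<epsilon> = \<bar>H1 z - H2 z\<bar> / 2"
  have "\<epsilon> > 0" using neq by (simp add: \<epsilon>_def)
  obtain e where e: "e > 0" "ball z e \<subseteq> S" using S by (meson openE)
  then have inS: "w \<in> S" if "w \<in> ball z e" for w using that by blast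
  have "continuous (at z) H1" "continuous (at z) H2"
    using H S by (auto simp: continuous_on_eq_continuous_at)
  then obtain d1 d2 where d: "d1 > 0" "d2 > 0"
    "\<And>w. dist w z < d1 \<Longrightarrow> dist (H1 w) (H1 z) < \<epsilon>"
    "\<And>w. dist w z < d2 \<Longrightarrow> dist (H2 w) (H2 z) < \<epsilon>"
    using \<open>\<epsilon> > 0\<close> by (metis continuous_at_eps_delta dist_norm)
  \<comment> \<open>Division by 3 makes \<open>2 * h\<close>, the radius in which the mean value
    points lie, strictly smaller than all three radii.\<close>
  define h where "h = min e (min d1 d2) / 3"
  have h: "0 < h" "2 * h < e" "2 * h < d1" "2 * h < d2" using e d by (auto simp: h_def)
  obtain w1 where w1: "w1 \<in> cball z (2 * h)"
    "f (z + 1 * h + \<i> * h) - f (z + 1 * h) - f (z + \<i> * h) + f z = h\<^sup>2 * H1 w1"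
    using second_difference_mean_value[of z e f 1 G1 \<i> H1 h] f(1)[OF inS] G(1)[OF inS] h by auto
  obtain w2 where w2: "w2 \<in> cball z (2 * h)"
    "f (z + \<i> * h + 1 * h) - f (z + \<i> * h) - f (z + 1 * h) + f z = h\<^sup>2 * H2 w2"
    using second_difference_mean_value[of z e f \<i> G2 1 H2 h] f(2)[OF inS] G(2)[OF inS] h by auto
  have "h\<^sup>2 * H1 w1 = h\<^sup>2 * H2 w2" using w1(2) w2(2) by (simp add: algebra_simps)
  then have "H1 w1 = H2 w2" using h by simp
  moreover have "dist (H1 w1) (H1 z) < \<epsilon>" "dist (H2 w2) (H2 z) < \<epsilon>"
    using d w1 w2 h by (auto simp: dist_commute)
  ultimately show False unfolding \<epsilon>_def dist_real_def by (smt (verit) field_sum_of_halves)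
qed

text \<open>The mean value argument concerns real functions, so it is applied to real and imaginary
  parts separately.\<close>

lemma mixed_pd_eq:
  fixes g :: "complex \<Rightarrow> complex"
  assumes "open S" "z \<in> S" "Ck_on 2 g S"
  shows "pd_v (pd_u g) z = pd_u (pd_v g) z"
proof -
  have d: "g differentiable (at w)" "pd_u g differentiable (at w)" "pd_v g differentiable (at w)"
    if "w \<in> S" for w
    using assms(3) that by (auto simp: numeral_2_eq_2)
  have c: "continuous_on S (pd_v (pd_u g))" "continuous_on S (pd_u (pd_v g))"
    using assms(3) by (auto simp: numeral_2_eq_2)
  have pd: "((\<lambda>t. k (w + of_real t)) has_vector_derivative pd_u k w) (at 0)"
    "((\<lambda>t. k (w + \<i> * of_real t)) has_vector_derivative pd_v k w) (at 0)"
    if "k differentiable (at w)" for k :: "complex \<Rightarrow> complex" and w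
    using has_derivative_pd[OF differentiable_pd[OF that]] by auto
  have R: "((\<lambda>t. Re (k t)) has_vector_derivative Re D) F"
     "((\<lambda>t. Im (k t)) has_vector_derivative Im D) F"
    if "(k has_vector_derivative D) F" for k D F
    using that bounded_linear.has_vector_derivative bounded_linear_Re bounded_linear_Im by blast+
  have "Re (pd_v (pd_u g) z) = Re (pd_u (pd_v g) z)"
    by (rule mixed_derivatives_eq_real[OF assms(1,2), where f = "\<lambda>w. Re (g w)"])
       (rule R pd d continuous_intros c | assumption)+
  moreover have "Im (pd_v (pd_u g) z) = Im (pd_u (pd_v g) z)"
    by (rule mixed_derivatives_eq_real[OF assms(1,2), where f = "\<lambda>w. Im (g w)"])
       (rule R pd d continuous_intros c | assumption)+
  ultimately show ?thesis by (simp add: complex_eq_iff)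
qed

text \<open>The shape is that of \<open>d_z\<close> and \<open>d_zbar\<close>:
  \<open>a = 1/2\<close> and \<open>b\<close> is \<open>-\<i>\<close> or
  \<open>\<i>\<close>.\<close>

lemma pd_linear:
  fixes f g :: "complex \<Rightarrow> complex"
  assumes "f differentiable (at z)" "g differentiable (at z)"
  shows "(\<lambda>w. a * (f w + b * g w)) differentiable (at z)"
    and "pd_u (\<lambda>w. a * (f w + b * g w)) z = a * (pd_u f z + b * pd_u g z)"
    and "pd_v (\<lambda>w. a * (f w + b * g w)) z = a * (pd_v f z + b * pd_v g z)"
proof -
  have "((\<lambda>w. a * (f w + b * g w)) has_derivative
     (\<lambda>h. a * ((Re h *\<^sub>R pd_u f z + Im h *\<^sub>R pd_v f z) + b * (Re h *\<^sub>R pd_u g z + Im h *\<^sub>R pd_v g z)))) (at z)"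
    by (intro derivative_intros differentiable_pd assms)
  from has_derivative_pd(3,4)[OF this] this
  show "(\<lambda>w. a * (f w + b * g w)) differentiable (at z)"
    "pd_u (\<lambda>w. a * (f w + b * g w)) z = a * (pd_u f z + b * pd_u g z)"
    "pd_v (\<lambda>w. a * (f w + b * g w)) z = a * (pd_v f z + b * pd_v g z)"
    by (auto simp: differentiable_def)
qed

text \<open>Once the mixed partial derivatives cancel, both iterated Wirtinger derivatives are a
  quarter of the Laplacian.\<close>

lemma Ck_on_2_wirt:
  fixes g :: "complex \<Rightarrow> complex"
  assumes "open S" "Ck_on 2 g S"
  shows "Ck_on 1 g S" "Ck_on 1 (d_zbar g) S"
    and "z \<in> S \<Longrightarrow> d_zbar (d_z g) z = d_z (d_zbar g) z"
proof -
  have d: "pd_u g differentiable (at w)" "pd_v g differentiable (at w)" if "w \<in> S" for w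
    using assms(2) that by (auto simp: numeral_2_eq_2)
  have 1: "Ck_on 1 (pd_u g) S" "Ck_on 1 (pd_v g) S"
    using assms(2) by (auto simp: numeral_2_eq_2)
  then show "Ck_on 1 g S"
    using assms(2) Ck_on_Suc_D[of 0 "pd_u g" S] Ck_on_Suc_D[of 0 "pd_v g" S]
    by (auto simp: numeral_2_eq_2)
  show "Ck_on 1 (d_zbar g) S"
    unfolding d_zbar_def[abs_def] by (intro Ck_on_1_mult Ck_on_1_add Ck_on_1_const 1)
  have dz: "d_z g = (\<lambda>w. (1/2) * (pd_u g w + (-\<i>) * pd_v g w))"
    "d_zbar g = (\<lambda>w. (1/2) * (pd_u g w + \<i> * pd_v g w))"
    by (auto simp: d_z_def d_zbar_def)
  assume z: "z \<in> S"
  have m: "pd_v (pd_u g) z = pd_u (pd_v g) z" using mixed_pd_eq assms z by blast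
  show "d_zbar (d_z g) z = d_z (d_zbar g) z"
    unfolding d_zbar_def[of "d_z g"] d_z_def[of "d_zbar g"]
    unfolding dz pd_linear[OF d[OF z]] m by (simp add: algebra_simps)
qed

section \<open>The Poincare lemma\<close>

text \<open>The potential is the integral of \<open>2 * Re (\<psi> dz)\<close> along the segment
  from a base point to \<open>z\<close>. Differentiation under the integral gives an exact
  \<open>t\<close>-derivative because the conjugate derivative \<open>r\<close> of
  \<open>\<psi>\<close> is real.\<close>

lemma potential_convex:
  assumes S: "open S" "convex S"
    and \<psi>: "\<And>z. z \<in> S \<Longrightarrow> has_wirt \<psi> (p z) (of_real (r z)) z"
    and p: "continuous_on S p" and r: "continuous_on S r"
  shows "\<exists>x::complex \<Rightarrow> real. \<forall>z\<in>S. (x has_derivative (\<lambda>h. 2 * Re (\<psi> z * h))) (at z)"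
proof (cases "S = {}")
  case False
  then obtain c where c: "c \<in> S" by blast
  define \<gamma> where "\<gamma> z t = c + of_real t * (z - c)" for z :: complex and t :: real
  \<comment> \<open>\<open>V z t\<close> is the gradient of \<open>k\<close> in \<open>z\<close>:
    \<open>Re (a * h)\<close> is the inner product of \<open>cnj a\<close> with \<open>h\<close>,
    and a real factor passes through conjugation.\<close>
  define V where "V z t = 2 * (cnj (of_real t * p (\<gamma> z t) * (z - c) + \<psi> (\<gamma> z t))
      + of_real (t * r (\<gamma> z t)) * (z - c))" for z t
  define k where "k z t = 2 * Re (\<psi> (\<gamma> z t) * (z - c))" for z t
  define x where "x z = integral {0..1} (k z)" for z
  have \<gamma>: "\<gamma> z t \<in> S" if "z \<in> S" "t \<in> {0..1}" for z t
  proof -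
    have "(1 - t) *\<^sub>R c + t *\<^sub>R z \<in> S"
      using that c S(2) by (auto intro: convexD_alt)
    then show ?thesis by (simp add: \<gamma>_def scaleR_conv_of_real algebra_simps)
  qed
  have der: "(\<psi> has_derivative (\<lambda>h. p w * h + of_real (r w) * cnj h)) (at w)" if "w \<in> S" for w
    using \<psi>[OF that] by (simp add: has_wirt_def)
  have \<psi>c: "continuous_on S \<psi>"
    using der by (meson continuous_at_imp_continuous_on has_derivative_continuous)
  have \<gamma>c: "continuous_on (S \<times> {0..1}) (\<lambda>y. \<gamma> (fst y) (snd y))"
    unfolding \<gamma>_def by (intro continuous_intros)
  have comp: "continuous_on (S \<times> {0..1}) (\<lambda>y. q (\<gamma> (fst y) (snd y)))"
    if "continuous_on S q" for q :: "complex \<Rightarrow> 'b::topological_space"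
    by (rule continuous_on_compose2[OF that \<gamma>c]) (auto intro: \<gamma>)
  have Vc: "continuous_on (S \<times> {0..1}) (\<lambda>y. V (fst y) (snd y))"
    unfolding V_def by (intro continuous_intros comp p r \<psi>c)
  have kc: "continuous_on (S \<times> {0..1}) (\<lambda>y. k (fst y) (snd y))"
    unfolding k_def by (intro continuous_intros comp \<psi>c)
  have slice: "continuous_on {0..1} (\<lambda>t. G z t)"
    if "continuous_on (S \<times> {0..1}) (\<lambda>y. G (fst y) (snd y))" "z \<in> S"
    for G :: "complex \<Rightarrow> real \<Rightarrow> 'b::topological_space" and z
  proof -
    have "continuous_on {0..1} (\<lambda>t::real. (z, t))" by (intro continuous_intros)
    moreover have "(\<lambda>t. (z, t)) ` {0..1} \<subseteq> S \<times> {0..1}" using that(2) by auto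
    ultimately show ?thesis using continuous_on_compose2[OF that(1)] by fastforce
  qed
  \<comment> \<open>The derivative is packaged as a bounded linear map, so that the Leibniz rule can
    integrate it over \<open>t\<close> as a vector-valued function.\<close>
  have k_der: "((\<lambda>z. k z t) has_derivative blinfun_apply (blinfun_inner_right (V z t))) (at z within S)"
    if z: "z \<in> S" and t: "t \<in> cbox 0 1" for z t
  proof -
    have 1: "((\<lambda>z. \<gamma> z t) has_derivative (\<lambda>h. of_real t * h)) (at z within S)"
      unfolding \<gamma>_def by (auto intro!: derivative_eq_intros)
    have "((\<lambda>z. k z t) has_derivative (\<lambda>h. 2 * Re (\<psi> (\<gamma> z t) * h +
        (p (\<gamma> z t) * (of_real t * h) + of_real (r (\<gamma> z t)) * cnj (of_real t * h)) * (z - c))))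
        (at z within S)"
      unfolding k_def
      using \<gamma>[OF z] t
      by (auto intro!: derivative_eq_intros has_derivative_compose[OF 1 der])
    moreover have "2 * Re (\<psi> (\<gamma> z t) * h +
        (p (\<gamma> z t) * (of_real t * h) + of_real (r (\<gamma> z t)) * cnj (of_real t * h)) * (z - c))
      = blinfun_apply (blinfun_inner_right (V z t)) h" for h
      unfolding V_def
      by (simp add: blinfun_inner_right.rep_eq inner_complex_def algebra_simps)
    ultimately show ?thesis by (simp only:)
  qed
  have "(x has_derivative (\<lambda>h. 2 * Re (\<psi> z * h))) (at z)" if z: "z \<in> S" for z
  proof -
    have "((\<lambda>z. integral (cbox 0 1) (k z)) has_derivative
        integral (cbox 0 1) (\<lambda>t. blinfun_inner_right (V z t))) (at z within S)"
    proof (rule leibniz_rule[OF k_der])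
      show "k z integrable_on cbox 0 1" if "z \<in> S" for z
        using slice[OF kc that] by (simp add: integrable_continuous_real)
      show "continuous_on (S \<times> cbox 0 1) (\<lambda>(z, t). blinfun_inner_right (V z t))"
        using bounded_linear.continuous_on[OF bounded_linear_blinfun_inner_right Vc]
        by (simp add: split_beta)
    qed (use z S in auto)
    then have 1: "(x has_derivative integral {0..1} (\<lambda>t. blinfun_inner_right (V z t))) (at z)"
      unfolding at_within_open[OF z S(1)] cbox_interval x_def[abs_def] .
    have "blinfun_apply (integral {0..1} (\<lambda>t. blinfun_inner_right (V z t))) h = 2 * Re (\<psi> z * h)" for h
    proof -
      have int: "(\<lambda>t. blinfun_inner_right (V z t)) integrable_on {0..1}"
        by (intro integrable_continuous_real bounded_linear.continuous_on[OF bounded_linear_blinfun_inner_right] slice Vc z)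
      \<comment> \<open>Explicit antiderivative of the directional derivative of the integrand. It
        vanishes at \<open>t = 0\<close> and equals \<open>2 * Re (\<psi> z * h)\<close> at
        \<open>t = 1\<close>. The two expressions match since
        \<open>Re (cnj s * h) = Re (s * cnj h)\<close> may be used under the real factor
        \<open>r\<close>.\<close>
      have "((\<lambda>t. t * (2 * Re (\<psi> (\<gamma> z t) * h))) has_vector_derivative (V z t \<bullet> h)) (at t within {0..1})"
        if t: "t \<in> {0..1}" for t
      proof -
        have 1: "((\<lambda>t. \<gamma> z t) has_derivative (\<lambda>s. of_real s * (z - c))) (at t within {0..1})"
          unfolding \<gamma>_def by (auto intro!: derivative_eq_intros)
        have "((\<lambda>t. t * (2 * Re (\<psi> (\<gamma> z t) * h))) has_derivative (\<lambda>s. t * (2 * Re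
          ((p (\<gamma> z t) * (of_real s * (z - c)) + of_real (r (\<gamma> z t)) * cnj (of_real s * (z - c))) * h))
           + s * (2 * Re (\<psi> (\<gamma> z t) * h)))) (at t within {0..1})"
          using \<gamma>[OF z t]
          by (auto intro!: derivative_eq_intros has_derivative_compose[OF 1 der])
        moreover have "t * (2 * Re
          ((p (\<gamma> z t) * (of_real s * (z - c)) + of_real (r (\<gamma> z t)) * cnj (of_real s * (z - c))) * h))
           + s * (2 * Re (\<psi> (\<gamma> z t) * h)) = s *\<^sub>R (V z t \<bullet> h)" for s
          unfolding V_def by (simp add: inner_complex_def algebra_simps)
        ultimately show ?thesis unfolding has_vector_derivative_def by (simp only:)
      qed
      from fundamental_theorem_of_calculus[OF _ this]
      have "((\<lambda>t. V z t \<bullet> h) has_integral 2 * Re (\<psi> z * h)) {0..1}"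
        by (simp add: \<gamma>_def)
      then have "integral {0..1} (\<lambda>t. V z t \<bullet> h) = 2 * Re (\<psi> z * h)" by (rule integral_unique)
      then show ?thesis
        by (simp add: blinfun_apply_integral[OF int] blinfun_inner_right.rep_eq)
    qed
    then have "blinfun_apply (integral {0..1} (\<lambda>t. blinfun_inner_right (V z t))) = (\<lambda>h. 2 * Re (\<psi> z * h))"
      by (rule ext)
    with 1 show ?thesis by (simp only:)
  qed
  then show ?thesis by blast
qed auto

text \<open>Reality of the derivative of \<open>\<phi>\<close> in the conjugate variable is the closedness of
  \<open>Re (\<phi> dz)\<close>. It is preserved by \<open>\<phi> \<mapsto> (\<phi> \<circ> g) g'\<close> for holomorphic \<open>g\<close>, so the Riemann mapping theorem
  reduces the claim to the disc.\<close>

lemma potential_simply_connected: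
  assumes S: "open S" "simply_connected S"
    and \<phi>: "Ck_on 1 \<phi> S" and real: "\<And>z. z \<in> S \<Longrightarrow> d_zbar \<phi> z \<in> \<real>"
  shows "\<exists>x::complex \<Rightarrow> real. \<forall>z\<in>S. (x has_derivative (\<lambda>h. 2 * Re (\<phi> z * h))) (at z)"
proof -
  note d = Ck_on_1D[OF \<phi>]
  have wirt: "has_wirt \<phi> (d_z \<phi> z) (of_real (Re (d_zbar \<phi> z))) z" if "z \<in> S" for z
    using d(1)[OF that] real[OF that] by simp
  have rc: "continuous_on S (\<lambda>z. Re (d_zbar \<phi> z))" by (intro continuous_intros d)
  \<comment> \<open>By the Riemann mapping theorem a simply connected open set is empty, the plane,
    or biholomorphic to the disc; the first two are convex.\<close>
  consider "convex S" | f g where "f holomorphic_on S" "g holomorphic_on ball 0 1"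
      "\<And>z. z \<in> S \<Longrightarrow> f z \<in> ball 0 1 \<and> g (f z) = z"
      "\<And>z. z \<in> ball 0 1 \<Longrightarrow> g z \<in> S \<and> f (g z) = z"
    using S simply_connected_eq_biholomorphic_to_disc[OF S(1)] by (metis convex_empty convex_UNIV)
  then show ?thesis
  proof cases
    case 1
    then show ?thesis using potential_convex[OF S(1) _ wirt d(3) rc] by blast
  next
    case 2
    let ?B = "ball (0::complex) 1"
    have g: "(g has_field_derivative deriv g w) (at w)"
      "(deriv g has_field_derivative deriv (deriv g) w) (at w)" if "w \<in> ?B" for w
      using 2(2) that by (auto intro!: holomorphic_derivI[of _ ?B] holomorphic_deriv)
    have gc: "continuous_on ?B g" "continuous_on ?B (deriv g)" "continuous_on ?B (deriv (deriv g))"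
      using 2(2) by (auto intro!: holomorphic_on_imp_continuous_on holomorphic_deriv)
    have comp: "continuous_on ?B (\<lambda>w. q (g w))" if "continuous_on S q"
      for q :: "complex \<Rightarrow> 'b::topological_space"
      by (rule continuous_on_compose2[OF that gc(1)]) (use 2(4) in auto)
    \<comment> \<open>Coefficient of the form pulled back to the disc, followed by its two Wirtinger
      derivatives. The factor \<open>deriv g\<close> meets its conjugate from the chain rule, which
      gives the real factor \<open>(cmod (deriv g w))\<^sup>2\<close>.\<close>
    define \<psi> where "\<psi> w = \<phi> (g w) * deriv g w" for w
    define p where "p w = d_z \<phi> (g w) * deriv g w * deriv g w + \<phi> (g w) * deriv (deriv g) w" for w
    define r where "r w = Re (d_zbar \<phi> (g w)) * (cmod (deriv g w))\<^sup>2" for w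
    have "has_wirt \<psi> (p w) (of_real (r w)) w" if w: "w \<in> ?B" for w
    proof -
      have "has_wirt \<psi> (p w) (of_real (Re (d_zbar \<phi> (g w))) * cnj (deriv g w) * deriv g w + \<phi> (g w) * 0) w"
        unfolding \<psi>_def p_def using 2(4)[OF w]
        by (intro has_wirt_mult has_wirt_chain_holomorphic wirt has_wirt_holomorphic g w) auto
      then show ?thesis
        by (simp add: r_def complex_norm_square[symmetric] mult.assoc mult.commute[of "cnj _"])
    qed
    moreover have "continuous_on ?B p" "continuous_on ?B r"
      unfolding p_def r_def by (intro continuous_intros comp gc rc d)+
    ultimately obtain x :: "complex \<Rightarrow> real"
      where x: "\<And>w. w \<in> ?B \<Longrightarrow> (x has_derivative (\<lambda>h. 2 * Re (\<psi> w * h))) (at w)"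
      using potential_convex[of ?B \<psi> p r] open_ball convex_ball by metis
    have "((\<lambda>z. x (f z)) has_derivative (\<lambda>h. 2 * Re (\<phi> z * h))) (at z)" if z: "z \<in> S" for z
    proof -
      have f: "(f has_field_derivative deriv f z) (at z)"
        using 2(1) z S(1) by (auto intro: holomorphic_derivI)
      have fz: "f z \<in> ?B" "g (f z) = z" using 2(3) z by auto
      \<comment> \<open>Differentiating \<open>g (f z) = z\<close> shows that the factor
        \<open>deriv g\<close> in \<open>\<psi>\<close> is undone by \<open>deriv f\<close> when the
        potential is carried back to \<open>S\<close>.\<close>
      have "((\<lambda>z. g (f z)) has_field_derivative deriv g (f z) * deriv f z) (at z)"
        by (rule DERIV_chain2[OF g(1)[OF fz(1)] f])
      moreover have "((\<lambda>z. g (f z)) has_field_derivative 1) (at z)"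
        by (rule has_field_derivative_transform_within_open[OF DERIV_ident S(1) z])
           (use 2(3) in auto)
      ultimately have "deriv g (f z) * deriv f z = 1" by (rule DERIV_unique)
      then have eq: "\<psi> (f z) * (deriv f z * h) = \<phi> z * h" for h
        unfolding \<psi>_def fz(2) by (metis (no_types, opaque_lifting) mult.assoc mult.right_neutral)
      show ?thesis
        using has_derivative_compose[OF f[unfolded has_field_derivative_def] x[OF fz(1)]]
        unfolding eq .
    qed
    then show ?thesis by blast
  qed
qed

section \<open>Surfaces with prescribed complex derivative\<close>

lemma has_derivative_vec_lambda:
  fixes f :: "'n::finite \<Rightarrow> 'a::real_normed_vector \<Rightarrow> 'b::euclidean_space"
  assumes "\<And>k. (f k has_derivative D k) (at x)"
  shows "((\<lambda>x. \<chi> k. f k x) has_derivative (\<lambda>h. \<chi> k. D k h)) (at x)"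
  unfolding has_derivative_componentwise_within[of "\<lambda>x. \<chi> k. f k x"]
  by (auto simp: Basis_vec_def inner_axis intro!: has_derivative_inner_left assms)

text \<open>Prepares the C^2 regularity of the surface, whose partial derivatives have components
  \<open>Re (2 * \<phi> k z)\<close> and \<open>Re (2 * \<i> * \<phi> k z)\<close>.\<close>

lemma Ck_on_1_vec_Re:
  fixes \<psi> :: "'n::finite \<Rightarrow> complex \<Rightarrow> complex"
  assumes "\<And>k. Ck_on 1 (\<psi> k) S"
  shows "Ck_on 1 (\<lambda>z. \<chi> k. Re (\<psi> k z)) S"
proof -
  have D: "((\<lambda>z. \<chi> k. Re (\<psi> k z)) has_derivative
      (\<lambda>h. \<chi> k. Re (d_z (\<psi> k) z * h + d_zbar (\<psi> k) z * cnj h))) (at z)" if "z \<in> S" for z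
    using Ck_on_1D(1)[OF assms that] unfolding has_wirt_def
    by (intro has_derivative_vec_lambda bounded_linear.has_derivative[OF bounded_linear_Re])
  have pd: "continuous_on S (pd_u (\<lambda>z. \<chi> k. Re (\<psi> k z)))
      = continuous_on S (\<lambda>z. \<chi> k. Re (d_z (\<psi> k) z * 1 + d_zbar (\<psi> k) z * cnj 1))"
    "continuous_on S (pd_v (\<lambda>z. \<chi> k. Re (\<psi> k z)))
      = continuous_on S (\<lambda>z. \<chi> k. Re (d_z (\<psi> k) z * \<i> + d_zbar (\<psi> k) z * cnj \<i>))"
    using has_derivative_pd(3,4)[OF D] by (auto intro: continuous_on_cong)
  have "continuous_on S (\<lambda>z. \<chi> k. Re (d_z (\<psi> k) z * c + d_zbar (\<psi> k) z * cnj c))" for c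
    by (intro continuous_intros Ck_on_1D(3,4)[OF assms])
  from this[of 1] this[of \<i>]
  have "continuous_on S (pd_u (\<lambda>z. \<chi> k. Re (\<psi> k z)))" "continuous_on S (pd_v (\<lambda>z. \<chi> k. Re (\<psi> k z)))"
    unfolding pd by blast+
  then show ?thesis using D unfolding One_nat_def Ck_on.simps differentiable_def by blast
qed

text \<open>Each coordinate is a potential of its own form. As
  \<open>2 * Re (\<phi> k z * h)\<close> is \<open>\<phi> k z * h\<close> plus its conjugate, the
  factor 2 makes the Wirtinger derivative exactly \<open>\<phi> k z\<close>.\<close>

lemma surface_with_derivative:
  fixes \<phi> :: "'n::finite \<Rightarrow> complex \<Rightarrow> complex"
  assumes S: "open S" "simply_connected S"
    and \<phi>: "\<And>k. Ck_on 1 (\<phi> k) S"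
    and real: "\<And>k z. z \<in> S \<Longrightarrow> d_zbar (\<phi> k) z \<in> \<real>"
  obtains X :: "complex \<Rightarrow> real ^ 'n"
    where "\<And>z. z \<in> S \<Longrightarrow> (X has_derivative (\<lambda>h. \<chi> k. 2 * Re (\<phi> k z * h))) (at z)"
      and "Ck_on 2 X S" and "\<And>z. z \<in> S \<Longrightarrow> surface_z X z = (\<chi> k. \<phi> k z)"
proof -
  have "\<forall>k. \<exists>x::complex \<Rightarrow> real. \<forall>z\<in>S. (x has_derivative (\<lambda>h. 2 * Re (\<phi> k z * h))) (at z)"
    using potential_simply_connected[OF S \<phi> real] by blast
  then obtain x :: "'n \<Rightarrow> complex \<Rightarrow> real"
    where x: "\<And>k z. z \<in> S \<Longrightarrow> (x k has_derivative (\<lambda>h. 2 * Re (\<phi> k z * h))) (at z)"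
    by metis
  define X where "X z = (\<chi> k. x k z)" for z
  have X: "(X has_derivative (\<lambda>h. \<chi> k. 2 * Re (\<phi> k z * h))) (at z)" if "z \<in> S" for z
    unfolding X_def by (intro has_derivative_vec_lambda x that)
  have "Ck_on 1 (pd_u X) S"
    by (rule Ck_on_cong[OF Ck_on_1_vec_Re[OF Ck_on_1_mult[OF Ck_on_1_const[of 2] \<phi>]] S(1)])
       (simp add: has_derivative_pd(3)[OF X])
  moreover have "Ck_on 1 (pd_v X) S"
    by (rule Ck_on_cong[OF Ck_on_1_vec_Re[OF Ck_on_1_mult[OF Ck_on_1_const[of "2 * \<i>"] \<phi>]] S(1)])
       (simp add: has_derivative_pd(4)[OF X])
  ultimately have "Ck_on 2 X S"
    using X by (auto simp: numeral_2_eq_2 differentiable_def)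
  moreover have "surface_z X z = (\<chi> k. \<phi> k z)" if z: "z \<in> S" for z
  proof -
    have "has_wirt (\<lambda>w. complex_of_real (x k w)) (\<phi> k z) (cnj (\<phi> k z)) z" for k
    proof -
      have "((\<lambda>w. complex_of_real (x k w)) has_derivative (\<lambda>h. of_real (2 * Re (\<phi> k z * h)))) (at z)"
        by (rule bounded_linear.has_derivative[OF bounded_linear_of_real x[OF z]])
      moreover have "complex_of_real (2 * Re (\<phi> k z * h)) = \<phi> k z * h + cnj (\<phi> k z) * cnj h" for h
        by (simp add: complex_eq_iff)
      ultimately show ?thesis unfolding has_wirt_def by simp
    qed
    from has_wirt_D(1)[OF this] show ?thesis
      unfolding surface_z_def vd_z_def cvec_def X_def by (simp add: vec_eq_iff)
  qed
  ultimately show ?thesis using that X by blast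
qed

section \<open>Induced metric, immersions and the translator equation\<close>

text \<open>For complex \<open>a\<close>, \<open>b\<close> one has
  \<open>2 * Re a * (2 * Re b) = 2 * Re (a * b) + 2 * Re (a * cnj b)\<close>. With
  \<open>a = \<phi> k z * v\<close> and \<open>b = \<phi> k z * w\<close>, the first terms sum to
  zero by the null condition and the second give the conformal metric.\<close>

lemma has_induced_metric_null_curve:
  fixes X :: "complex \<Rightarrow> real ^ 'n"
  assumes X: "\<And>z. z \<in> S \<Longrightarrow> (X has_derivative (\<lambda>h. \<chi> k. 2 * Re (\<phi> k z * h))) (at z)"
    and null: "\<And>z. z \<in> S \<Longrightarrow> (\<Sum>k\<in>UNIV. (\<phi> k z)\<^sup>2) = 0"
  shows "has_induced_metric X S (\<lambda>z. 2 * (\<Sum>k\<in>UNIV. (cmod (\<phi> k z))\<^sup>2))"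
  unfolding has_induced_metric_def
proof (intro ballI allI)
  fix z v w assume z: "z \<in> S"
  have "frechet_derivative X (at z) = (\<lambda>h. \<chi> k. 2 * Re (\<phi> k z * h))"
    using frechet_derivative_at[OF X[OF z]] by simp
  then have "induced_metric X z v w = (\<Sum>k\<in>UNIV. 2 * Re (\<phi> k z * v) * (2 * Re (\<phi> k z * w)))"
    by (simp add: induced_metric_def inner_vec_def)
  also have "\<dots> = (\<Sum>k\<in>UNIV. 2 * Re ((\<phi> k z)\<^sup>2 * (v * w)) + 2 * (cmod (\<phi> k z))\<^sup>2 * (v \<bullet> w))"
    by (intro sum.cong refl)
       (simp only: inner_complex_def cmod_power2, simp add: power2_eq_square algebra_simps)
  also have "\<dots> = 2 * Re ((\<Sum>k\<in>UNIV. (\<phi> k z)\<^sup>2) * (v * w)) + 2 * (\<Sum>k\<in>UNIV. (cmod (\<phi> k z))\<^sup>2) * (v \<bullet> w)"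
    by (simp only: sum.distrib sum_distrib_left sum_distrib_right Re_sum)
  also have "\<dots> = 2 * (\<Sum>k\<in>UNIV. (cmod (\<phi> k z))\<^sup>2) * (v \<bullet> w)"
    using null[OF z] by simp
  finally show "induced_metric X z v w = 2 * (\<Sum>k\<in>UNIV. (cmod (\<phi> k z))\<^sup>2) * (v \<bullet> w)" .
qed

text \<open>A vector killed by the differential has \<open>L z * (h \<bullet> h) = 0\<close>, so a
  positive factor makes the differential injective.\<close>

lemma conformal_immersionI:
  assumes "Ck_on 2 X S" "has_induced_metric X S L" "\<And>z. z \<in> S \<Longrightarrow> L z > 0"
  shows "conformal_immersion X S"
proof -
  have "inj (frechet_derivative X (at z))" if z: "z \<in> S" for z
  proof -
    have "X differentiable (at z)" using assms(1) z by (auto simp: numeral_2_eq_2)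
    then have lin: "linear (frechet_derivative X (at z))" by (rule linear_frechet_derivative)
    have "h = 0" if "frechet_derivative X (at z) h = 0" for h
    proof -
      have "L z * (h \<bullet> h) = 0"
        using assms(2) z that unfolding has_induced_metric_def induced_metric_def
        by (metis inner_zero_left)
      then show ?thesis using assms(3)[OF z] by simp
    qed
    then show ?thesis using linear_injective_0[OF lin] by blast
  qed
  then show ?thesis using assms unfolding conformal_immersion_def by blast
qed

text \<open>Two candidates differ by a vector lying both in \<open>T\<close> and in its orthogonal
  complement, hence by zero; this justifies the definite description.\<close>

lemma normal_component_eq:
  fixes T :: "'a::euclidean_space set"
  assumes "subspace T" "N \<in> orthogonal_comp T" "V - N \<in> T"
  shows "normal_component T V = N"
  unfolding normal_component_def
proof (rule the_equality)
  fix M assume M: "M \<in> orthogonal_comp T \<and> V - M \<in> T"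
  have "(V - N) - (V - M) \<in> T" using subspace_diff[OF assms(1,3)] M by blast
  also have "(V - N) - (V - M) = M - N" by simp
  finally have "M - N \<in> T" .
  moreover have "M - N \<in> orthogonal_comp T"
    using M assms(2) by (auto intro: subspace_diff subspace_orthogonal_comp)
  ultimately have "orthogonal (M - N) (M - N)" by (auto simp: orthogonal_comp_def)
  then show "M = N" by (simp add: orthogonal_def)
qed (use assms in auto)

text \<open>The assumed conjugate derivative presents the mean curvature vector as the velocity
  minus a tangent vector. Conformality then shows that this difference is normal, so it is the
  normal component.\<close>

lemma is_translatorI:
  fixes X :: "complex \<Rightarrow> real ^ 'n"
  assumes S: "open S"
    and X: "\<And>z. z \<in> S \<Longrightarrow> (X has_derivative (\<lambda>h. \<chi> k. 2 * Re (\<phi> k z * h))) (at z)"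
    and Xz: "\<And>z. z \<in> S \<Longrightarrow> surface_z X z = (\<chi> k. \<phi> k z)"
    and L: "has_induced_metric X S L" "\<And>z. z \<in> S \<Longrightarrow> L z > 0"
    and \<phi>: "\<And>k z. z \<in> S \<Longrightarrow> has_wirt (\<phi> k) (p k z)
      (of_real (Re (cnj (\<phi> m z) * \<phi> k z) - (if k = m then L z / 4 else 0))) z"
  shows "is_translator X S (- axis m 1)"
  unfolding is_translator_def
proof
  fix z assume z: "z \<in> S"
  let ?V = "- axis m 1 :: real ^ 'n"
  define D where "D h = (\<chi> k. 2 * Re (\<phi> k z * h))" for h
  \<comment> \<open>The mean curvature vector, read off from the assumed conjugate derivative of
    \<open>\<phi>\<close>; the term with \<open>k = m\<close> contributes exactly
    \<open>- axis m 1\<close>.\<close>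
  define N where "N = (\<chi> k. 4 / L z * (Re (cnj (\<phi> m z) * \<phi> k z) - (if k = m then L z / 4 else 0)))"
  \<comment> \<open>Chosen so that \<open>D v\<close> is the tangential part of the velocity:
    conformality gives \<open>D h \<bullet> D v = L z * (h \<bullet> v)\<close>, which has to equal
    \<open>- 2 * Re (\<phi> m z * h)\<close> for all \<open>h\<close>.\<close>
  define v where "v = - (2 / L z) *\<^sub>R cnj (\<phi> m z)"
  have D: "frechet_derivative X (at z) = D"
    unfolding D_def using frechet_derivative_at[OF X[OF z]] by (simp only:)
  then have T: "tangent_plane X z = range D" by (simp add: tangent_plane_def)
  have lin: "linear D"
    using has_derivative_bounded_linear[OF X[OF z]] unfolding D_def by (rule bounded_linear.linear)
  have metric: "D h \<bullet> D k = L z * (h \<bullet> k)" for h k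
    using L(1) z unfolding has_induced_metric_def induced_metric_def D[symmetric] by blast
  have VN: "?V - N = D v"
    using L(2)[OF z]
    by (auto simp: vec_eq_iff N_def D_def v_def axis_def field_simps)
  have "N \<in> orthogonal_comp (range D)"
  proof -
    have "D h \<bullet> N = 0" for h
    proof -
      have "D h \<bullet> N = D h \<bullet> ?V - D h \<bullet> D v"
        using VN by (metis add_diff_cancel_left' diff_add_cancel inner_diff_right)
      also have "D h \<bullet> ?V = - 2 * Re (\<phi> m z * h)"
        by (simp add: inner_axis D_def)
      also have "D h \<bullet> D v = - 2 * Re (\<phi> m z * h)"
        unfolding metric v_def using L(2)[OF z] by (simp add: inner_complex_def field_simps)
      finally show ?thesis by simp
    qed
    then show ?thesis by (auto simp: orthogonal_comp_def orthogonal_def)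
  qed
  then have "normal_component (tangent_plane X z) ?V = N"
    unfolding T using VN linear_subspace_image[OF lin subspace_UNIV]
    by (intro normal_component_eq) auto
  moreover have "mean_curvature_vector X z = cvec N"
  proof -
    have "vd_zbar (surface_z X) z $ k
      = of_real (Re (cnj (\<phi> m z) * \<phi> k z) - (if k = m then L z / 4 else 0))" for k
    proof -
      have "has_wirt (\<lambda>w. surface_z X w $ k) (p k z)
        (of_real (Re (cnj (\<phi> m z) * \<phi> k z) - (if k = m then L z / 4 else 0))) z"
        by (rule has_wirt_cong[OF \<phi>[OF z] S z]) (simp add: Xz)
      then show ?thesis by (simp add: vd_zbar_def has_wirt_D(2))
    qed
    moreover have "conformal_factor X z = L z"
      using L(1) z by (simp add: conformal_factor_def has_induced_metric_def)
    ultimately show ?thesis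
      by (simp add: mean_curvature_vector_def vec_eq_iff cvec_def N_def)
  qed
  ultimately show "mean_curvature_vector X z = cvec (normal_component (tangent_plane X z) ?V)"
    by simp
qed

section \<open>The Gauss map equations\<close>

text \<open>Lets one computation for (I) serve (II) as well, with the two functions
  exchanged.\<close>

lemma equation_II_swap: "equation_II g1 g2 z \<longleftrightarrow> equation_I g2 g1 z"
  unfolding equation_I_def equation_II_def by (simp add: mult.commute add.commute)

text \<open>Differentiating the formula for \<open>d_zbar a\<close> in \<open>z\<close> expresses
  the second derivative in (I) through \<open>d_z F\<close>. The terms with \<open>d_z a\<close>
  cancel and the rest is a nonzero multiple of the asserted equation.\<close>

lemma equation_I_iff:
  assumes S: "open S" "z \<in> S" and a: "Ck_on 2 a S" and b: "Ck_on 1 b S" and F: "Ck_on 1 F S"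
    and nz: "1 - a z * cnj (b z) \<noteq> 0" "1 + a z * cnj (a z) \<noteq> 0"
    and a_zbar: "\<And>w. w \<in> S \<Longrightarrow>
      d_zbar a w = F w * ((1 - a w * cnj (b w)) * (1 + a w * cnj (a w)))"
    and b_zbar: "d_zbar b z = F z * ((1 - cnj (a z) * b z) * (1 + b z * cnj (b z)))"
  shows "equation_I a b z \<longleftrightarrow>
    d_z F z = - (F z * cnj (F z)) * (a z + b z - a z * b z * (cnj (a z) + cnj (b z)))"
proof -
  note wF = Ck_on_1D(1)[OF F S(2)] and wb = Ck_on_1D(1)[OF b S(2)]
    and wa = Ck_on_1D(1)[OF Ck_on_2_wirt(1)[OF S(1) a] S(2)]
  let ?A = "cnj (a z)" and ?B = "cnj (b z)" and ?E = "cnj (F z)"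
  let ?D = "(1 - a z * ?B) * (1 + a z * ?A)"
  have nz': "1 - ?A * b z \<noteq> 0" "1 + ?A * a z \<noteq> 0"
    using nz complex_cnj_cancel_iff[of "1 - a z * ?B" 0] by (simp_all add: mult.commute)
  have az: "d_zbar a z = F z * ?D" using a_zbar S(2) by blast
  have "has_wirt (\<lambda>w. F w * ((1 - a w * cnj (b w)) * (1 + a w * cnj (a w))))
     (d_z F z * ?D + F z * ((0 - (d_z a z * ?B + a z * cnj (d_zbar b z))) * (1 + a z * ?A)
        + (1 - a z * ?B) * (0 + (d_z a z * ?A + a z * cnj (d_zbar a z)))))
     (d_zbar F z * ?D + F z * ((0 - (d_zbar a z * ?B + a z * cnj (d_z b z))) * (1 + a z * ?A)
        + (1 - a z * ?B) * (0 + (d_zbar a z * ?A + a z * cnj (d_z a z))))) z"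
    by (intro has_wirt_mult has_wirt_diff has_wirt_add has_wirt_const has_wirt_cnj wa wb wF)
  from has_wirt_D(1)[OF has_wirt_cong[OF this S]] a_zbar
  have "d_z (d_zbar a) z = d_z F z * ?D + F z * ((0 - (d_z a z * ?B + a z * cnj (d_zbar b z))) * (1 + a z * ?A)
        + (1 - a z * ?B) * (0 + (d_z a z * ?A + a z * cnj (d_zbar a z))))"
    by simp
  then have 1: "d_zbar (d_z a) z = d_z F z * ?D
      + F z * (- (d_z a z * ?B + a z * (?E * ((1 - a z * ?B) * (1 + b z * ?B)))) * (1 + a z * ?A)
        + (1 - a z * ?B) * (d_z a z * ?A + a z * (?E * ((1 - ?A * b z) * (1 + a z * ?A)))))"
    using Ck_on_2_wirt(3)[OF S(1) a S(2)] unfolding az b_zbar by (simp add: mult.commute)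
  \<comment> \<open>Cleared of denominators, this term is the negative of the part of
    \<open>1\<close> that contains \<open>d_z a z\<close>.\<close>
  have 2: "(?B / (1 - a z * ?B) - ?A / (1 + a z * ?A)) * d_z a z * (F z * ?D)
      = F z * d_z a z * (?B * (1 + a z * ?A) - ?A * (1 - a z * ?B))"
  proof -
    have "(x / u - y / v) * d * (e * (u * v)) = e * d * (x * v - y * u)"
      if "u \<noteq> 0" "v \<noteq> 0" for x y u v d e :: complex
      using that by (simp add: field_simps)
    then show ?thesis using nz by blast
  qed
  \<comment> \<open>The squared modulus is \<open>F z * ?D\<close> times its conjugate, and the
    conjugate of \<open>?D\<close> is exactly the denominator in (I).\<close>
  have 3: "(a z + b z) / ((1 - ?A * b z) * (1 + a z * ?A)) * (F z * ?D * cnj (F z * ?D))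
      = (a z + b z) * (F z * ?E) * ?D"
  proof -
    have "x / (u * v) * (e * d * (e' * (u * v))) = x * (e * e') * d"
      if "u \<noteq> 0" "v \<noteq> 0" for x u v d e e' :: complex
      using that by (simp add: field_simps)
    moreover have "cnj (F z * ?D) = ?E * ((1 - ?A * b z) * (1 + a z * ?A))"
      by (simp add: mult.commute)
    ultimately show ?thesis using nz nz' by simp
  qed
  have "equation_I a b z \<longleftrightarrow>
      0 = ?D * (d_z F z + F z * ?E * (a z + b z - a z * b z * (?A + ?B)))"
    unfolding equation_I_def complex_norm_square az 2 3 1 by (simp add: algebra_simps)
  also have "\<dots> \<longleftrightarrow> d_z F z + F z * ?E * (a z + b z - a z * b z * (?A + ?B)) = 0"
    using nz by auto
  also have "\<dots> \<longleftrightarrow> d_z F z = - (F z * ?E) * (a z + b z - a z * b z * (?A + ?B))"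
    by (simp add: eq_neg_iff_add_eq_0)
  finally show ?thesis .
qed

section \<open>The Gauss vector and the conjugate derivative of its multiple\<close>

lemma gauss_vec_nth [simp]:
  "gauss_vec a b $ 1 = 1 + a * b" "gauss_vec a b $ 2 = \<i> * (1 - a * b)"
  "gauss_vec a b $ 3 = a - b" "gauss_vec a b $ 4 = - \<i> * (a + b)"
  unfolding gauss_vec_def vector_def by simp_all

text \<open>The first two squares add up to \<open>4 * a * b\<close>, the last two to
  \<open>- 4 * a * b\<close>.\<close>

lemma gauss_vec_null: "(\<Sum>k\<in>UNIV. (c * gauss_vec a b $ k)\<^sup>2) = 0"
  by (simp add: sum_4 power_mult_distrib) (simp add: power2_eq_square algebra_simps)

text \<open>Parallelogram identity for the pair \<open>1\<close>, \<open>a * b\<close> and for the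
  pair \<open>a\<close>, \<open>b\<close>.\<close>

lemma gauss_vec_norm:
  "(\<Sum>k\<in>UNIV. (cmod (c * gauss_vec a b $ k))\<^sup>2)
    = 2 * (cmod c)\<^sup>2 * (1 + (cmod a)\<^sup>2) * (1 + (cmod b)\<^sup>2)"
  by (simp add: sum_4 norm_mult power_mult_distrib)
     (simp only: cmod_power2, simp add: power2_eq_square algebra_simps)

text \<open>The conjugate derivative of \<open>cnj F\<close> is the conjugate of the prescribed
  \<open>d_z F\<close>, and those of \<open>a\<close> and \<open>b\<close> are given. Hence each
  coordinate is a polynomial identity in \<open>a\<close>, \<open>b\<close>, \<open>F\<close> and
  their conjugates.\<close>

lemma d_zbar_gauss_vec_multiple:
  fixes a b F :: "complex \<Rightarrow> complex" and k :: 4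
  assumes wa: "has_wirt a az (F z * ((1 - a z * cnj (b z)) * (1 + a z * cnj (a z)))) z"
    and wb: "has_wirt b bz (F z * ((1 - cnj (a z) * b z) * (1 + b z * cnj (b z)))) z"
    and wF: "has_wirt F (- (F z * cnj (F z)) * (a z + b z - a z * b z * (cnj (a z) + cnj (b z)))) Fzb z"
  defines "\<phi> \<equiv> \<lambda>k w. - 2 * \<i> * cnj (F w) * gauss_vec (a w) (b w) $ k"
  shows "d_zbar (\<phi> k) z = of_real (Re (cnj (\<phi> 4 z) * \<phi> k z)
    - (if k = 4 then 16 * (cmod (F z))\<^sup>2 * (1 + (cmod (a z))\<^sup>2) * (1 + (cmod (b z))\<^sup>2) / 4 else 0))"
proof -
  note w = has_wirt_mult[OF has_wirt_mult[OF has_wirt_const has_wirt_cnj[OF wF]]]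
  \<comment> \<open>Writing real parts through conjugates makes both sides polynomial.\<close>
  have re: "complex_of_real (Re x) = (x + cnj x) / 2" for x
    by (simp add: complex_eq_iff)
  have ii: "\<i> * (\<i> * x) = - x" for x :: complex by (simp add: mult.assoc[symmetric])
  consider "k = 1" | "k = 2" | "k = 3" | "k = 4" using exhaust_4 by blast
  then show ?thesis
  proof cases
    case 1
    show ?thesis unfolding \<phi>_def 1 gauss_vec_nth
      unfolding has_wirt_D(2)[OF w[OF has_wirt_add[OF has_wirt_const has_wirt_mult[OF wa wb]]]]
      by (simp only: of_real_diff re) (simp add: field_simps ii)
  next
    case 2
    show ?thesis unfolding \<phi>_def 2 gauss_vec_nth
      unfolding has_wirt_D(2)[OF w[OF has_wirt_mult[OF has_wirt_const has_wirt_diff[OF has_wirt_const has_wirt_mult[OF wa wb]]]]]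
      by (simp only: of_real_diff re) (simp add: field_simps ii)
  next
    case 3
    show ?thesis unfolding \<phi>_def 3 gauss_vec_nth
      unfolding has_wirt_D(2)[OF w[OF has_wirt_diff[OF wa wb]]]
      by (simp only: of_real_diff re) (simp add: field_simps ii)
  next
    case 4
    have L: "complex_of_real (16 * (cmod (F z))\<^sup>2 * (1 + (cmod (a z))\<^sup>2) * (1 + (cmod (b z))\<^sup>2) / 4)
      = 4 * (F z * cnj (F z)) * (1 + a z * cnj (a z)) * (1 + b z * cnj (b z))"
      by (simp add: complex_norm_square[symmetric])
    show ?thesis unfolding \<phi>_def 4 gauss_vec_nth
      unfolding has_wirt_D(2)[OF w[OF has_wirt_mult[OF has_wirt_const has_wirt_add[OF wa wb]]]]
      by (simp only: of_real_diff re L refl if_True) (simp add: field_simps ii)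
  qed
qed

section \<open>The translator with prescribed complexified Gauss map\<close>

theorem theorem2:
  fixes \<Omega> :: "complex set"
    and g1 g2 F f :: "complex \<Rightarrow> complex"
    and \<phi> :: "complex \<Rightarrow> complex ^ 4"
  assumes "open \<Omega>" and "connected \<Omega>" and "\<Omega> \<noteq> {}" and "simply_connected \<Omega>"
    and "g1 ` \<Omega> \<subseteq> ball 0 1" and "g2 ` \<Omega> \<subseteq> ball 0 1"
    and "Ck_on 2 g1 \<Omega>" and "Ck_on 2 g2 \<Omega>"
    and "nowhere_holomorphic g1 \<Omega>" and "nowhere_holomorphic g2 \<Omega>"
    and F_g1: "\<And>z. z \<in> \<Omega> \<Longrightarrow>
      F z = d_zbar g1 z / ((1 - g1 z * cnj (g2 z)) * (1 + of_real ((cmod (g1 z))\<^sup>2)))"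
    and F_g2: "\<And>z. z \<in> \<Omega> \<Longrightarrow>
      F z = d_zbar g2 z / ((1 - cnj (g1 z) * g2 z) * (1 + of_real ((cmod (g2 z))\<^sup>2)))"
    and I_or_II: "(\<forall>z\<in>\<Omega>. equation_I g1 g2 z) \<or> (\<forall>z\<in>\<Omega>. equation_II g1 g2 z)"
    and f_eq: "\<And>z. z \<in> \<Omega> \<Longrightarrow> f z = - 2 * \<i> * cnj (F z)"
    and phi_eq: "\<And>z. z \<in> \<Omega> \<Longrightarrow> \<phi> z = f z *s gauss_vec (g1 z) (g2 z)"
  shows
    "(\<forall>z\<in>\<Omega>. equation_I g1 g2 z) \<and> (\<forall>z\<in>\<Omega>. equation_II g1 g2 z) \<and>
     (\<forall>z\<in>\<Omega>. (\<phi> z $ 1)\<^sup>2 + (\<phi> z $ 2)\<^sup>2 + (\<phi> z $ 3)\<^sup>2 + (\<phi> z $ 4)\<^sup>2 = 0) \<and>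
     (\<forall>z\<in>\<Omega>. (cmod (\<phi> z $ 1))\<^sup>2 + (cmod (\<phi> z $ 2))\<^sup>2
            + (cmod (\<phi> z $ 3))\<^sup>2 + (cmod (\<phi> z $ 4))\<^sup>2 > 0) \<and>
     (\<forall>z\<in>\<Omega>. \<phi> differentiable (at z) \<and> vd_zbar \<phi> z \<in> range cvec) \<and>
     (\<exists>X :: complex \<Rightarrow> real ^ 4.
        conformal_immersion X \<Omega> \<and>
        (\<forall>z\<in>\<Omega>. surface_z X z = \<phi> z) \<and>
        has_induced_metric X \<Omega>
          (\<lambda>z. 16 * (cmod (d_zbar g1 z))\<^sup>2 / (cmod (1 - g1 z * cnj (g2 z)))\<^sup>2
               * ((1 + (cmod (g2 z))\<^sup>2) / (1 + (cmod (g1 z))\<^sup>2))) \<and>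
        has_induced_metric X \<Omega>
          (\<lambda>z. 16 * (cmod (d_zbar g2 z))\<^sup>2 / (cmod (1 - cnj (g1 z) * g2 z))\<^sup>2
               * ((1 + (cmod (g1 z))\<^sup>2) / (1 + (cmod (g2 z))\<^sup>2))) \<and>
        complexified_gauss_map X \<Omega> g1 g2 \<and>
        is_translator X \<Omega> (- axis 4 1))"
proof -
  let ?d = "\<lambda>z. 1 - g1 z * cnj (g2 z)" and ?d' = "\<lambda>z. 1 - cnj (g1 z) * g2 z"
  let ?m = "\<lambda>g z. 1 + g z * cnj (g z) :: complex"
  \<comment> \<open>The coordinates of \<open>\<phi>\<close> given by one formula on the whole
    plane, since \<open>f\<close> and \<open>\<phi>\<close> are prescribed only on
    \<open>\<Omega>\<close>. \<open>L\<close> will be the conformal factor.\<close>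
  define \<psi> where "\<psi> k z = - 2 * \<i> * cnj (F z) * gauss_vec (g1 z) (g2 z) $ k" for k z
  define L where "L z = 16 * (cmod (F z))\<^sup>2 * (1 + (cmod (g1 z))\<^sup>2) * (1 + (cmod (g2 z))\<^sup>2)" for z
  have m: "?m g z = of_real (1 + (cmod (g z))\<^sup>2)" for g z
    by (simp add: complex_norm_square[symmetric])
  have m_nz: "?m g z \<noteq> 0" for g z
    unfolding m of_real_eq_0_iff by (smt (verit) zero_le_power2)
  have d_nz: "?d z \<noteq> 0" "?d' z \<noteq> 0" if "z \<in> \<Omega>" for z
  proof -
    have "cmod (g1 z) < 1" "cmod (g2 z) < 1" using assms(5,6) that by auto
    then have "cmod (g1 z) * cmod (g2 z) < 1"
      by (smt (verit) mult_le_cancel_left1 norm_ge_zero mult_left_le)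
    then have "cmod (g1 z * cnj (g2 z)) \<noteq> 1" "cmod (cnj (g1 z) * g2 z) \<noteq> 1"
      by (simp_all add: norm_mult)
    then show "?d z \<noteq> 0" "?d' z \<noteq> 0" by (metis eq_iff_diff_eq_0 norm_one)+
  qed
  note C1 = Ck_on_2_wirt(1,2)[OF assms(1,7)] Ck_on_2_wirt(1)[OF assms(1,8)]
  have g1_zbar: "d_zbar g1 z = F z * (?d z * ?m g1 z)" if "z \<in> \<Omega>" for z
    using F_g1[OF that, unfolded complex_norm_square] d_nz[OF that] m_nz[of g1 z] by simp
  have g2_zbar: "d_zbar g2 z = F z * (?d' z * ?m g2 z)" if "z \<in> \<Omega>" for z
    using F_g2[OF that, unfolded complex_norm_square] d_nz[OF that] m_nz[of g2 z] by simp
  \<comment> \<open>\<open>F\<close> contains a first derivative of \<open>g1\<close>, so it is of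
    class C^1; this makes \<open>\<psi>\<close> of class C^1 and its potentials of class
    C^2.\<close>
  have "Ck_on 1 (\<lambda>z. d_zbar g1 z / (?d z * ?m g1 z)) \<Omega>"
    using d_nz(1) m_nz[of g1]
    by (intro Ck_on_1_divide Ck_on_1_mult Ck_on_1_diff Ck_on_1_add Ck_on_1_const Ck_on_1_cnj C1) simp_all
  then have F: "Ck_on 1 F \<Omega>"
    by (rule Ck_on_cong[OF _ assms(1)]) (simp only: F_g1 complex_norm_square)
  \<comment> \<open>Nowhere-holomorphy becomes nonvanishing of \<open>F\<close>, hence positivity of
    the conformal factor.\<close>
  have F_nz: "F z \<noteq> 0" if "z \<in> \<Omega>" for z
    using assms(9) g1_zbar[OF that] that by (auto simp: nowhere_holomorphic_def)
  have I: "equation_I g1 g2 z \<longleftrightarrow> d_z F z = - (F z * cnj (F z))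
      * (g1 z + g2 z - g1 z * g2 z * (cnj (g1 z) + cnj (g2 z)))" if z: "z \<in> \<Omega>" for z
    by (rule equation_I_iff[OF assms(1) z assms(7) C1(3) F d_nz(1)[OF z] m_nz[of g1 z] g1_zbar g2_zbar[OF z]])
  have "?d' z = 1 - g2 z * cnj (g1 z)" "?d z = 1 - cnj (g2 z) * g1 z" for z
    by (simp_all add: mult.commute)
  then have II: "equation_II g1 g2 z \<longleftrightarrow> d_z F z = - (F z * cnj (F z))
      * (g1 z + g2 z - g1 z * g2 z * (cnj (g1 z) + cnj (g2 z)))" if z: "z \<in> \<Omega>" for z
    unfolding equation_II_swap
    using equation_I_iff[OF assms(1) z assms(8) C1(1) F _ m_nz[of g2 z]] d_nz(2)[OF z] g1_zbar[OF z] g2_zbar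
    by (simp add: add.commute mult.commute)
  \<comment> \<open>Both equations are equivalent, point by point, to the same symmetric condition
    on \<open>d_z F\<close>.\<close>
  have a: "equation_I g1 g2 z" "equation_II g1 g2 z" if "z \<in> \<Omega>" for z
    using I_or_II I II that by blast+
  have \<phi>: "\<phi> z $ k = \<psi> k z" if "z \<in> \<Omega>" for z k
    using phi_eq[OF that] f_eq[OF that] by (simp add: \<psi>_def vector_scalar_mult_def)
  have \<phi>_vec: "\<phi> z = (\<chi> k. \<psi> k z)" if "z \<in> \<Omega>" for z
    using \<phi>[OF that] by (simp add: vec_eq_iff)
  have "Ck_on 1 (\<lambda>z. gauss_vec (g1 z) (g2 z) $ k) \<Omega>" for k
  proof -
    consider "k = 1" | "k = 2" | "k = 3" | "k = 4" using exhaust_4 by blast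
    then show ?thesis
      by cases (simp only: gauss_vec_nth, intro Ck_on_1_mult Ck_on_1_diff Ck_on_1_add Ck_on_1_const C1)+
  qed
  then have \<psi>: "Ck_on 1 (\<psi> k) \<Omega>" for k
    unfolding \<psi>_def by (intro Ck_on_1_mult Ck_on_1_const Ck_on_1_cnj F)
  \<comment> \<open>Equation (I), in the form \<open>I\<close>, supplies the value of
    \<open>d_z F\<close> needed here.\<close>
  have \<psi>_zbar: "d_zbar (\<psi> k) z = of_real (Re (cnj (\<psi> 4 z) * \<psi> k z) - (if k = 4 then L z / 4 else 0))"
    if z: "z \<in> \<Omega>" for k z
    unfolding L_def \<psi>_def
    using Ck_on_1D(1)[OF C1(1) z] Ck_on_1D(1)[OF C1(3) z] Ck_on_1D(1)[OF F z] a(1)[OF z]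
    unfolding g1_zbar[OF z] g2_zbar[OF z] I[OF z]
    by (intro d_zbar_gauss_vec_multiple[where az = "d_z g1 z" and bz = "d_z g2 z"]) simp_all
  \<comment> \<open>The constant 16 is \<open>2 * 2 * 4\<close>: from the metric, from
    \<open>gauss_vec_norm\<close>, and from the squared modulus of
    \<open>- 2 * \<i>\<close>.\<close>
  have L: "L z = 2 * (\<Sum>k\<in>UNIV. (cmod (\<psi> k z))\<^sup>2)" for z
    unfolding \<psi>_def gauss_vec_norm L_def by (simp add: norm_mult power_mult_distrib)
  have L_pos: "L z > 0" if "z \<in> \<Omega>" for z
    unfolding L_def using F_nz[OF that] by (intro mult_pos_pos) (auto simp: add_pos_nonneg)
  have null: "(\<Sum>k\<in>UNIV. (\<psi> k z)\<^sup>2) = 0" for z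
    unfolding \<psi>_def by (rule gauss_vec_null)
  have wirt: "has_wirt (\<psi> k) (d_z (\<psi> k) z)
      (of_real (Re (cnj (\<psi> 4 z) * \<psi> k z) - (if k = 4 then L z / 4 else 0))) z" if "z \<in> \<Omega>" for k z
    using Ck_on_1D(1)[OF \<psi> that] unfolding \<psi>_zbar[OF that] .
  have b1: "(\<phi> z $ 1)\<^sup>2 + (\<phi> z $ 2)\<^sup>2 + (\<phi> z $ 3)\<^sup>2 + (\<phi> z $ 4)\<^sup>2 = 0" if "z \<in> \<Omega>" for z
    using null[of z] by (simp add: \<phi>[OF that] sum_4)
  have b2: "(cmod (\<phi> z $ 1))\<^sup>2 + (cmod (\<phi> z $ 2))\<^sup>2 + (cmod (\<phi> z $ 3))\<^sup>2 + (cmod (\<phi> z $ 4))\<^sup>2 > 0"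
    if "z \<in> \<Omega>" for z
    using L_pos[OF that] L[of z] by (simp add: \<phi>[OF that] sum_4)
  have b3: "\<phi> differentiable (at z)" "vd_zbar \<phi> z \<in> range cvec" if z: "z \<in> \<Omega>" for z
  proof -
    have "((\<lambda>z. \<chi> k. \<psi> k z) has_derivative (\<lambda>h. \<chi> k. d_z (\<psi> k) z * h + d_zbar (\<psi> k) z * cnj h)) (at z)"
      using Ck_on_1D(1)[OF \<psi> z] unfolding has_wirt_def by (rule has_derivative_vec_lambda)
    from has_derivative_transform_within_open[OF this assms(1) z \<phi>_vec[symmetric]]
    show "\<phi> differentiable (at z)" unfolding differentiable_def by blast
    have "d_zbar (\<lambda>w. \<phi> w $ k) z = of_real (Re (cnj (\<psi> 4 z) * \<psi> k z) - (if k = 4 then L z / 4 else 0))" for k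
      by (rule has_wirt_D(2), rule has_wirt_cong[OF wirt[OF z] assms(1) z]) (simp add: \<phi>)
    then have "vd_zbar \<phi> z = cvec (\<chi> k. Re (cnj (\<psi> 4 z) * \<psi> k z) - (if k = 4 then L z / 4 else 0))"
      unfolding vd_zbar_def cvec_def by (simp add: vec_eq_iff)
    then show "vd_zbar \<phi> z \<in> range cvec" by blast
  qed
  have real: "d_zbar (\<psi> k) z \<in> \<real>" if "z \<in> \<Omega>" for k z
    unfolding \<psi>_zbar[OF that] by (rule Reals_of_real)
  obtain X :: "complex \<Rightarrow> real ^ 4"
    where X: "\<And>z. z \<in> \<Omega> \<Longrightarrow> (X has_derivative (\<lambda>h. \<chi> k. 2 * Re (\<psi> k z * h))) (at z)"
      and X2: "Ck_on 2 X \<Omega>" and Xz: "\<And>z. z \<in> \<Omega> \<Longrightarrow> surface_z X z = (\<chi> k. \<psi> k z)"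
    using surface_with_derivative[where \<phi> = \<psi>, OF assms(1,4) \<psi> real] by blast
  have metric: "has_induced_metric X \<Omega> L"
    using has_induced_metric_null_curve[OF X null] unfolding L[abs_def] by blast
  have metric_cong: "has_induced_metric X \<Omega> K" if "\<And>z. z \<in> \<Omega> \<Longrightarrow> K z = L z" for K
    using metric that unfolding has_induced_metric_def by simp
  have m_pos: "1 + (cmod (g z))\<^sup>2 \<noteq> 0" for g :: "complex \<Rightarrow> complex" and z
    by (smt (verit) zero_le_power2)
  \<comment> \<open>Used with \<open>e = cmod (F z)\<close>, \<open>d\<close> the modulus of the
    compatibility denominator, and \<open>m\<close>, \<open>n\<close> the factors
    \<open>1 + (cmod (g1 z))\<^sup>2\<close> and \<open>1 + (cmod (g2 z))\<^sup>2\<close> in either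
    order. Both displayed metrics thus become \<open>L\<close>.\<close>
  have cancel: "16 * (e * (d * m))\<^sup>2 / d\<^sup>2 * (n / m) = 16 * e\<^sup>2 * m * n" if "d \<noteq> 0" "m \<noteq> 0"
    for e d m n :: real
    using that by (simp add: field_simps power2_eq_square)
  have cmod_m: "cmod (?m g z) = 1 + (cmod (g z))\<^sup>2" for g z
    unfolding m norm_of_real by simp
  have c2: "has_induced_metric X \<Omega>
      (\<lambda>z. 16 * (cmod (d_zbar g1 z))\<^sup>2 / (cmod (?d z))\<^sup>2 * ((1 + (cmod (g2 z))\<^sup>2) / (1 + (cmod (g1 z))\<^sup>2)))"
    by (rule metric_cong)
       (simp only: g1_zbar norm_mult cmod_m cancel m_pos norm_eq_zero d_nz L_def not_False_eq_True)
  have c2': "has_induced_metric X \<Omega>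
      (\<lambda>z. 16 * (cmod (d_zbar g2 z))\<^sup>2 / (cmod (?d' z))\<^sup>2 * ((1 + (cmod (g1 z))\<^sup>2) / (1 + (cmod (g2 z))\<^sup>2)))"
    by (rule metric_cong)
       (simp only: g2_zbar norm_mult cmod_m cancel m_pos norm_eq_zero d_nz L_def not_False_eq_True, simp)
  have c3: "complexified_gauss_map X \<Omega> g1 g2"
    unfolding complexified_gauss_map_def
  proof
    fix z assume z: "z \<in> \<Omega>"
    have G: "gauss_map X z = proj_class (\<phi> z)"
      by (simp add: gauss_map_def Xz[OF z] \<phi>_vec[OF z])
    \<comment> \<open>Scaling by the nonzero number \<open>f z\<close> does not change the
      projective point; representatives are matched by multiplying or dividing \<open>c\<close> by
      \<open>f z\<close>.\<close>
    have f: "f z \<noteq> 0" using F_nz[OF z] f_eq[OF z] by simp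
    have "proj_class (\<phi> z) = proj_class (gauss_vec (g1 z) (g2 z))"
      unfolding phi_eq[OF z] proj_class_def
    proof (intro Collect_cong iffI; elim exE conjE)
      fix x c assume "x = c *s (f z *s gauss_vec (g1 z) (g2 z))" "c \<noteq> 0"
      then show "\<exists>c. x = c *s gauss_vec (g1 z) (g2 z) \<and> c \<noteq> 0"
        using f by (intro exI[of _ "c * f z"]) (simp add: vector_smult_assoc)
    next
      fix x c assume "x = c *s gauss_vec (g1 z) (g2 z)" "c \<noteq> 0"
      then show "\<exists>c. x = c *s (f z *s gauss_vec (g1 z) (g2 z)) \<and> c \<noteq> 0"
        using f by (intro exI[of _ "c / f z"]) (simp add: vector_smult_assoc)
    qed
    moreover have "\<phi> z \<noteq> 0" using b2[OF z] by auto
    then have "proj_class (\<phi> z) \<in> quadric2"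
      unfolding quadric2_def using b1[OF z] by blast
    ultimately show "gauss_map X z = proj_class (gauss_vec (g1 z) (g2 z)) \<and> gauss_map X z \<in> quadric2"
      using G by simp
  qed
  have "is_translator X \<Omega> (- axis 4 1)"
    by (rule is_translatorI[OF assms(1) X Xz metric L_pos wirt])
  then show ?thesis
    using a b1 b2 b3 X2 conformal_immersionI[OF X2 metric L_pos] Xz \<phi>_vec c2 c2' c3 by auto
qed

end
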